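(* Let $\mathcal{X},\mathcal{Y}$ be real finite dimensional Euclidean spaces, $\mathcal{A}:\mathcal{X}\to\mathcal{Y}$ a linear map, $c\in\mathcal{X}$, $p:\mathcal{X}\to(-\infty,+\infty]$ a closed proper convex function, and let $h:\mathcal{Y}\to\mathbb{R}$ be a convex differentiable function whose gradient is $1/\alpha_h$-Lipschitz continuous for some $\alpha_h>0$ and which is essentially locally strongly convex. Consider the problems $$(\mathbf{P})\quad \max\,-\{f(x)=h(\mathcal{A}x)-\langle c,x\rangle+p(x)\},\qquad (\mathbf{D})\quad \min\{h^*(y)+p^*(z)\mid\mathcal{A}^*y+z=c\},$$ and suppose that the solution set $\Omega$ of $(\mathbf{P})$ is nonempty. Suppose that $\mathcal{T}_f:=\partial f$ satisfies the error bound condition for the origin with modulus $a_f$. Let $\{(y^k,z^k,x^k)\}$ be any infinite sequence generated by Algorithm SSNAL (the inexact augmented Lagrangian method for $(\mathbf{D})$ described in the context) with stopping criteria (A) and (B1). Then the sequence $\{x^k\}$ converges to some $x^*\in\Omega$, and for all $k$ sufficiently large $$\mathrm{dist}(x^{k+1},\Omega)\le\theta_k\,\mathrm{dist}(x^k,\Omega),$$ where $$\theta_k=\big(a_f(a_f^2+\sigma_k^2)^{-1/2}+2\delta_k\big)(1-\delta_k)^{-1}\to\theta_\infty=a_f(a_f^2+\sigma_\infty^2)^{-1/2}<1\quad\text{as }k\to+\infty$$ (with $\theta_\infty=0$ if $\sigma_\infty=\infty$). Moreover, the sequence $\{(y^k,z^k)\}$ converges to the unique optimal solution $(y^*,z^*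 )\in\mathrm{int}(\mathrm{dom}\,h^* )\times\mathrm{dom}\,p^*$ of $(\mathbf{D})$. Moreover, if $\mathcal{T}_l$ is metrically subregular at $(y^*,z^*,x^* )$ for the origin with modulus $a_l$ and the stopping criterion (B2) is also used, then for all $k$ sufficiently large $$\|(y^{k+1},z^{k+1})-(y^*,z^* )\|\le\theta_k'\,\|x^{k+1}-x^k\|,$$ where $\theta_k'=a_l(1+\delta_k')/\sigma_k$ with $\lim_{k\to\infty}\theta_k'=a_l/\sigma_\infty$ (interpreted as $0$ if $\sigma_\infty=\infty$).
   Context: $h^*,p^*$ denote Fenchel conjugates and $\mathcal{A}^*$ the adjoint of $\mathcal{A}$; $\mathrm{dist}(x,C)=\inf_{x'\in C}\|x-x'\|$ (equal to $+\infty$ if $C=\emptyset$); for a multivalued mapping $F$, $F^{-1}(v)=\{u\mid v\in F(u)\}$. Essentially locally strongly convex: for any compact convex set $K\subset\mathrm{dom}\,\partial h$ there exists $\beta_K>0$ such that $(1-\lambda)h(y')+\lambda h(y)\ge h((1-\lambda)y'+\lambda y)+\frac12\beta_K\lambda(1-\lambda)\|y'-y\|^2$ for all $y',y\in K$ and all $\lambda\in[0,1]$. Error bound condition: $F$ satisfies the error bound condition for a point $v$ (with $F^{-1}(v)\neq\emptyset$) with modulus $\kappa\ge0$ if there exists $\varepsilon>0$ such that every $u$ with $\mathrm{dist}(v,F(u))\le\varepsilon$ satisfies $\mathrm{dist}(u,F^{-1}(v))\le\kappa\,\mathrm{dist}(v,F(u))$. Metric subregularity: $F$ is metrically subregular at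 $\bar u$ for $\bar v$ (where $\bar v\in F(\bar u)$) with modulus $\kappa\ge0$ if there exist neighborhoods $U$ of $\bar u$ and $V$ of $\bar v$ such that $\mathrm{dist}(u,F^{-1}(\bar v))\le\kappa\,\mathrm{dist}(\bar v,F(u)\cap V)$ for all $u\in U$. Lagrangian and $\mathcal{T}_l$: $l(y,z,x)=h^*(y)+p^*(z)-\langle x,\mathcal{A}^*y+z-c\rangle$ on $\mathcal{Y}\times\mathcal{X}\times\mathcal{X}$, and $\mathcal{T}_l(y,z,x)=\{(y',z',x')\mid(y',z',-x')\in\partial l(y,z,x)\}$ ($\partial l$: subgradients in $(y,z)$ paired with supergradients in $x$); explicitly $\mathcal{T}_l(y,z,x)=(\partial h^*(y)-\mathcal{A}x)\times(\partial p^*(z)-x)\times\{\mathcal{A}^*y+z-c\}$. Augmented Lagrangian of $(\mathbf{D})$, for $\sigma>0$: $\mathcal{L}_\sigma(y,z;x)=l(y,z,x)+\frac{\sigma}{2}\|\mathcal{A}^*y+z-c\|^2$. Algorithm SSNAL: let $\sigma_0>0$ be given and choose $(y^0,z^0,x^0)\in\mathrm{int}(\mathrm{dom}\,h^* )\times\mathrm{dom}\,p^*\times\mathcal{X}$. For $k=0,1,\ldots$: (Step 1) compute an approximate minimizer $(y^{k+1},z^{k+1})\approx\arg\min\{\Psi_k(y,z):=\mathcal{L}_{\sigma_k}(y,z;x^k)\}$, where "approximate" means satisfying the stopping criteria in force; (Step 2) set $x^{k+1}=x^k-\sigma_k(\mathcal{A}^*y^{k+1}+z^{k+1}-c)$ and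 update $\sigma_{k+1}\uparrow\sigma_\infty\le\infty$ (i.e. $\{\sigma_k\}$ is a nondecreasing sequence of positive numbers with limit $\sigma_\infty\in(0,+\infty]$). Stopping criteria: (A) $\Psi_k(y^{k+1},z^{k+1})-\inf\Psi_k\le\varepsilon_k^2/(2\sigma_k)$, with $\varepsilon_k\ge0$, $\sum_{k=0}^\infty\varepsilon_k<\infty$; (B1) $\Psi_k(y^{k+1},z^{k+1})-\inf\Psi_k\le(\delta_k^2/(2\sigma_k))\|x^{k+1}-x^k\|^2$, with $\delta_k\ge0$, $\sum_{k=0}^\infty\delta_k<+\infty$; (B2) $\mathrm{dist}(0,\partial\Psi_k(y^{k+1},z^{k+1}))\le(\delta_k'/\sigma_k)\|x^{k+1}-x^k\|$, with $0\le\delta_k'\to0$. In (B1) and (B2), $x^{k+1}=x^k-\sigma_k(\mathcal{A}^*y^{k+1}+z^{k+1}-c)$. *)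

theory Defs
  imports "HOL-Analysis.Analysis"
begin

section \<open>Extended-real-valued convex analysis\<close>

definition effdom :: "('a \<Rightarrow> ereal) \<Rightarrow> 'a set" where
  "effdom f = {x. f x < \<infinity>}"

definition proper_fun :: "('a \<Rightarrow> ereal) \<Rightarrow> bool" where
  "proper_fun f \<longleftrightarrow> (\<forall>x. f x \<noteq> -\<infinity>) \<and> effdom f \<noteq> {}"

text \<open>The library's \<open>epigraph\<close> is restricted to real-valued functions.\<close>

definition ereal_epigraph :: "('a \<Rightarrow> ereal) \<Rightarrow> ('a \<times> real) set" where
  "ereal_epigraph f = {(x, r). f x \<le> ereal r}"

definition closed_proper_convex :: "('a::euclidean_space \<Rightarrow> ereal) \<Rightarrow> bool" where
  "closed_proper_convex f \<longleftrightarrow>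
     proper_fun f \<and> convex (ereal_epigraph f) \<and> closed (ereal_epigraph f)"

definition conjugate :: "('a::real_inner \<Rightarrow> ereal) \<Rightarrow> 'a \<Rightarrow> ereal" where
  "conjugate f v = (SUP x. ereal (v \<bullet> x) - f x)"

definition subdiff :: "('a::real_inner \<Rightarrow> ereal) \<Rightarrow> 'a \<Rightarrow> 'a set" where
  "subdiff f x = {v. \<forall>x'. f x + ereal (v \<bullet> (x' - x)) \<le> f x'}"

lemma subdiff_empty:
  assumes "proper_fun f" "f x = \<infinity>" shows "subdiff f x = {}"
  using assms by (force simp: subdiff_def proper_fun_def effdom_def)

definition superdiff :: "('a::real_inner \<Rightarrow> ereal) \<Rightarrow> 'a \<Rightarrow> 'a set" where
  "superdiff f x = {v. \<forall>x'. f x' \<le> f x + ereal (v \<bullet> (x' - x))}"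

definition ess_locally_strongly_convex :: "('a::euclidean_space \<Rightarrow> ereal) \<Rightarrow> bool" where
  "ess_locally_strongly_convex f \<longleftrightarrow>
     (\<forall>K. compact K \<and> convex K \<and> K \<subseteq> {x. subdiff f x \<noteq> {}} \<longrightarrow>
        (\<exists>\<beta>>0. \<forall>y'\<in>K. \<forall>y\<in>K. \<forall>t\<in>{0..1}.
           ereal (1 - t) * f y' + ereal t * f y
             \<ge> f ((1 - t) *\<^sub>R y' + t *\<^sub>R y)
                + ereal (1/2 * \<beta> * t * (1 - t) * (norm (y' - y))\<^sup>2)))"

section \<open>Distances and multivalued mappings\<close>

text \<open>In contrast to \<open>infdist\<close>, which is \<open>0\<close> there, the distance to the empty set is \<open>\<infinity>\<close>.\<close>

definition set_dist :: "'a::real_normed_vector \<Rightarrow> 'a set \<Rightarrow> ereal" where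
  "set_dist x C = (INF x'\<in>C. ereal (norm (x - x')))"

definition mv_inv :: "('a \<Rightarrow> 'b set) \<Rightarrow> 'b \<Rightarrow> 'a set" where
  "mv_inv F v = {u. v \<in> F u}"

definition error_bound ::
  "('a::real_normed_vector \<Rightarrow> 'b::real_normed_vector set) \<Rightarrow> 'b \<Rightarrow> real \<Rightarrow> bool" where
  "error_bound F v \<kappa> \<longleftrightarrow>
     mv_inv F v \<noteq> {} \<and> \<kappa> \<ge> 0 \<and>
     (\<exists>\<epsilon>>0. \<forall>u. set_dist v (F u) \<le> ereal \<epsilon> \<longrightarrow>
        set_dist u (mv_inv F v) \<le> ereal \<kappa> * set_dist v (F u))"

text \<open>The guard \<open>F u \<inter> V \<noteq> {}\<close> matters only for \<open>\<kappa> = 0\<close>: the right-hand side is then meant to be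
  \<open>\<infinity>\<close> when \<open>F u \<inter> V\<close> is empty, whereas \<open>0 * \<infinity> = 0\<close> in \<open>ereal\<close>.\<close>

definition metrically_subregular ::
  "('a::real_normed_vector \<Rightarrow> 'b::real_normed_vector set) \<Rightarrow> 'a \<Rightarrow> 'b \<Rightarrow> real \<Rightarrow> bool" where
  "metrically_subregular F u0 v0 \<kappa> \<longleftrightarrow>
     v0 \<in> F u0 \<and> \<kappa> \<ge> 0 \<and>
     (\<exists>U V. open U \<and> u0 \<in> U \<and> open V \<and> v0 \<in> V \<and>
        (\<forall>u\<in>U. F u \<inter> V \<noteq> {} \<longrightarrow>
           set_dist u (mv_inv F v0) \<le> ereal \<kappa> * set_dist v0 (F u \<inter> V)))"

section \<open>The primal and dual problems\<close>

definition primal_obj ::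
  "('b \<Rightarrow> real) \<Rightarrow> ('a::euclidean_space \<Rightarrow> ereal) \<Rightarrow> ('a \<Rightarrow> 'b) \<Rightarrow> 'a \<Rightarrow> 'a \<Rightarrow> ereal" where
  "primal_obj h p A c x = ereal (h (A x)) - ereal (c \<bullet> x) + p x"

definition primal_solutions ::
  "('b \<Rightarrow> real) \<Rightarrow> ('a::euclidean_space \<Rightarrow> ereal) \<Rightarrow> ('a \<Rightarrow> 'b) \<Rightarrow> 'a \<Rightarrow> 'a set" where
  "primal_solutions h p A c =
     {x. \<forall>x'. - primal_obj h p A c x' \<le> - primal_obj h p A c x}"

definition dual_obj ::
  "('b::euclidean_space \<Rightarrow> real) \<Rightarrow> ('a::euclidean_space \<Rightarrow> ereal) \<Rightarrow> 'b \<Rightarrow> 'a \<Rightarrow> ereal" where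
  "dual_obj h p y z = conjugate (\<lambda>u. ereal (h u)) y + conjugate p z"

definition dual_solutions ::
  "('b::euclidean_space \<Rightarrow> real) \<Rightarrow> ('a::euclidean_space \<Rightarrow> ereal) \<Rightarrow> ('a \<Rightarrow> 'b) \<Rightarrow> 'a
     \<Rightarrow> ('b \<times> 'a) set" where
  "dual_solutions h p A c =
     {(y, z). adjoint A y + z = c \<and>
        (\<forall>y' z'. adjoint A y' + z' = c \<longrightarrow> dual_obj h p y z \<le> dual_obj h p y' z')}"

definition lagrangian ::
  "('b::euclidean_space \<Rightarrow> real) \<Rightarrow> ('a::euclidean_space \<Rightarrow> ereal) \<Rightarrow> ('a \<Rightarrow> 'b) \<Rightarrow> 'a
     \<Rightarrow> 'b \<Rightarrow> 'a \<Rightarrow> 'a \<Rightarrow> ereal" where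
  "lagrangian h p A c y z x =
     conjugate (\<lambda>u. ereal (h u)) y + conjugate p z - ereal (x \<bullet> (adjoint A y + z - c))"

definition lagrangian_subdiff ::
  "('b::euclidean_space \<Rightarrow> real) \<Rightarrow> ('a::euclidean_space \<Rightarrow> ereal) \<Rightarrow> ('a \<Rightarrow> 'b) \<Rightarrow> 'a
     \<Rightarrow> 'b \<times> 'a \<times> 'a \<Rightarrow> ('b \<times> 'a \<times> 'a) set" where
  "lagrangian_subdiff h p A c = (\<lambda>(y, z, x).
     {(y', z', x'). (y', z') \<in> subdiff (\<lambda>(y, z). lagrangian h p A c y z x) (y, z)
                  \<and> x' \<in> superdiff (\<lambda>x. lagrangian h p A c y z x) x})"

definition T_l ::
  "('b::euclidean_space \<Rightarrow> real) \<Rightarrow> ('a::euclidean_space \<Rightarrow> ereal) \<Rightarrow> ('a \<Rightarrow> 'b) \<Rightarrow> 'a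
     \<Rightarrow> 'b \<times> 'a \<times> 'a \<Rightarrow> ('b \<times> 'a \<times> 'a) set" where
  "T_l h p A c u = {(y', z', x'). (y', z', - x') \<in> lagrangian_subdiff h p A c u}"

lemma T_l_explicit:
  fixes h :: "'b::euclidean_space \<Rightarrow> real" and p :: "'a::euclidean_space \<Rightarrow> ereal"
  assumes "linear A" and ph: "proper_fun (conjugate (\<lambda>u. ereal (h u)))" and pp: "proper_fun (conjugate p)"
  shows "T_l h p A c (y, z, x) =
     (\<lambda>v. v - A x) ` subdiff (conjugate (\<lambda>u. ereal (h u))) y \<times> (\<lambda>v. v - x) ` subdiff (conjugate p) z
       \<times> {adjoint A y + z - c}"
proof -
  define H where "H = conjugate (\<lambda>u. ereal (h u))"
  define P where "P = conjugate p"
  have H: "proper_fun H" and P: "proper_fun P" using ph pp by (simp_all add: H_def P_def)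
  have lin: "x \<bullet> adjoint A u = A x \<bullet> u" for u
    by (rule adjoint_works[OF assms(1)])
  have Hn: "H u \<noteq> -\<infinity>" and Pn: "P w \<noteq> -\<infinity>" for u w using H P by (auto simp: proper_fun_def)
  have L: "lagrangian h p A c u w v = H u + P w - ereal (v \<bullet> (adjoint A u + w - c))" for u w v
    by (simp add: lagrangian_def H_def P_def)
  obtain u0 w0 where u0: "H u0 \<noteq> \<infinity>" and w0: "P w0 \<noteq> \<infinity>"
    using H P by (auto simp: proper_fun_def effdom_def)
  have sub: "(y', z') \<in> subdiff (\<lambda>(y, z). lagrangian h p A c y z x) (y, z)
    \<longleftrightarrow> y' + A x \<in> subdiff H y \<and> z' + x \<in> subdiff P z" (is "?L \<longleftrightarrow> ?R") for y' z'
  proof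
    assume l: ?L
    have l2: "H y + P z - ereal (x \<bullet> (adjoint A y + z - c)) + ereal (y' \<bullet> (u - y) + z' \<bullet> (w - z))
       \<le> H u + P w - ereal (x \<bullet> (adjoint A u + w - c))" for u w
      using l by (auto simp: subdiff_def L)
    have fin: "H y \<noteq> \<infinity>" "P z \<noteq> \<infinity>"
      using l2[of u0 w0] u0 w0 Hn[of u0] Pn[of w0] Hn[of y] Pn[of z]
      by (cases "H u0"; cases "P w0"; cases "H y"; cases "P z"; simp)+
    then obtain a b where ab: "H y = ereal a" "P z = ereal b"
      using Hn[of y] Pn[of z] by (cases "H y"; cases "P z"; auto)
    show ?R
    proof (clarsimp simp: subdiff_def, intro conjI allI)
      fix u show "H y + ereal ((y' + A x) \<bullet> (u - y)) \<le> H u"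
        using l2[of u z] ab Hn[of u]
        by (cases "H u"; simp add: inner_simps lin)
    next
      fix w show "P z + ereal ((z' + x) \<bullet> (w - z)) \<le> P w"
        using l2[of y w] ab Pn[of w]
        by (cases "P w"; simp add: inner_simps lin)
    qed
  next
    assume r: ?R
    then have fin: "H y \<noteq> \<infinity>" "P z \<noteq> \<infinity>" using subdiff_empty H P by blast+
    then obtain a b where ab: "H y = ereal a" "P z = ereal b"
      using Hn[of y] Pn[of z] by (cases "H y"; cases "P z"; auto)
    show ?L
    proof (clarsimp simp: subdiff_def L)
      fix u w
      have "H y + ereal ((y' + A x) \<bullet> (u - y)) \<le> H u" "P z + ereal ((z' + x) \<bullet> (w - z)) \<le> P w"
        using r by (auto simp: subdiff_def)
      then show "H y + P z - ereal (x \<bullet> (adjoint A y + z - c)) + ereal (y' \<bullet> (u - y) + z' \<bullet> (w - z))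
       \<le> H u + P w - ereal (x \<bullet> (adjoint A u + w - c))"
        using ab Hn[of u] Pn[of w]
        by (cases "H u"; cases "P w"; simp add: inner_simps lin)
    qed
  qed
  have sup: "- x' \<in> superdiff (\<lambda>x. lagrangian h p A c y z x) x \<longleftrightarrow> x' = adjoint A y + z - c"
    if fin: "H y \<noteq> \<infinity>" "P z \<noteq> \<infinity>" for x'
  proof -
    obtain a b where ab: "H y = ereal a" "P z = ereal b"
      using fin Hn[of y] Pn[of z] by (cases "H y"; cases "P z"; auto)
    let ?r = "adjoint A y + z - c"
    have "- x' \<in> superdiff (\<lambda>x. lagrangian h p A c y z x) x
        \<longleftrightarrow> (\<forall>v. (x' - ?r) \<bullet> (v - x) \<le> 0)"
      by (simp add: superdiff_def L ab inner_commute algebra_simps)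
    also have "\<dots> \<longleftrightarrow> x' = ?r"
    proof
      assume "\<forall>v. (x' - ?r) \<bullet> (v - x) \<le> 0"
      from this[rule_format, of "x + (x' - ?r)"] have "(x' - ?r) \<bullet> (x' - ?r) \<le> 0" by simp
      then have "x' - ?r = 0" using inner_gt_zero_iff[of "x' - ?r"] by fastforce
      then show "x' = ?r" by simp
    qed simp
    finally show ?thesis .
  qed
  have "(y', z', x') \<in> T_l h p A c (y, z, x) \<longleftrightarrow>
     y' + A x \<in> subdiff H y \<and> z' + x \<in> subdiff P z \<and> x' = adjoint A y + z - c" for y' z' x'
    using sub[of y' z'] sup[of x'] subdiff_empty[OF H, of y] subdiff_empty[OF P, of z]
    by (auto simp: T_l_def lagrangian_subdiff_def)
  moreover have "y' + A x \<in> subdiff H y \<longleftrightarrow> y' \<in> (\<lambda>v. v - A x) ` subdiff H y" for y'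
    by (auto simp: image_iff) (metis add_diff_cancel)
  moreover have "z' + x \<in> subdiff P z \<longleftrightarrow> z' \<in> (\<lambda>v. v - x) ` subdiff P z" for z'
    by (auto simp: image_iff) (metis add_diff_cancel)
  ultimately show ?thesis unfolding H_def[symmetric] P_def[symmetric]
    by (auto simp: set_eq_iff)
qed

definition aug_lagrangian ::
  "('b::euclidean_space \<Rightarrow> real) \<Rightarrow> ('a::euclidean_space \<Rightarrow> ereal) \<Rightarrow> ('a \<Rightarrow> 'b) \<Rightarrow> 'a
     \<Rightarrow> real \<Rightarrow> 'b \<Rightarrow> 'a \<Rightarrow> 'a \<Rightarrow> ereal" where
  "aug_lagrangian h p A c \<sigma> y z x =
     lagrangian h p A c y z x + ereal (\<sigma> / 2 * (norm (adjoint A y + z - c))\<^sup>2)"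

section \<open>The inexact augmented Lagrangian method\<close>

text \<open>The inner problem is only solved approximately; in what sense is specified separately, by the
  stopping criteria below.\<close>

definition ssnal_sequence ::
  "('b::euclidean_space \<Rightarrow> real) \<Rightarrow> ('a::euclidean_space \<Rightarrow> ereal) \<Rightarrow> ('a \<Rightarrow> 'b) \<Rightarrow> 'a
     \<Rightarrow> (nat \<Rightarrow> real) \<Rightarrow> ereal \<Rightarrow> (nat \<Rightarrow> 'b) \<Rightarrow> (nat \<Rightarrow> 'a) \<Rightarrow> (nat \<Rightarrow> 'a) \<Rightarrow> bool" where
  "ssnal_sequence h p A c \<sigma> \<sigma>_inf y z x \<longleftrightarrow>
     (\<forall>k. \<sigma> k > 0) \<and> incseq \<sigma> \<and> (\<lambda>k. ereal (\<sigma> k)) \<longlonglongrightarrow> \<sigma>_inf \<and>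
     y 0 \<in> interior (effdom (conjugate (\<lambda>u. ereal (h u)))) \<and>
     z 0 \<in> effdom (conjugate p) \<and>
     (\<forall>k. x (Suc k) = x k - \<sigma> k *\<^sub>R (adjoint A (y (Suc k)) + z (Suc k) - c))"

definition Psi ::
  "('b::euclidean_space \<Rightarrow> real) \<Rightarrow> ('a::euclidean_space \<Rightarrow> ereal) \<Rightarrow> ('a \<Rightarrow> 'b) \<Rightarrow> 'a
     \<Rightarrow> (nat \<Rightarrow> real) \<Rightarrow> (nat \<Rightarrow> 'a) \<Rightarrow> nat \<Rightarrow> 'b \<times> 'a \<Rightarrow> ereal" where
  "Psi h p A c \<sigma> x k = (\<lambda>(y, z). aug_lagrangian h p A c (\<sigma> k) y z (x k))"

definition stop_A ::
  "('b::euclidean_space \<Rightarrow> real) \<Rightarrow> ('a::euclidean_space \<Rightarrow> ereal) \<Rightarrow> ('a \<Rightarrow> 'b) \<Rightarrow> 'a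
     \<Rightarrow> (nat \<Rightarrow> real) \<Rightarrow> (nat \<Rightarrow> 'b) \<Rightarrow> (nat \<Rightarrow> 'a) \<Rightarrow> (nat \<Rightarrow> 'a) \<Rightarrow> (nat \<Rightarrow> real) \<Rightarrow> bool" where
  "stop_A h p A c \<sigma> y z x \<epsilon> \<longleftrightarrow>
     (\<forall>k. \<epsilon> k \<ge> 0) \<and> summable \<epsilon> \<and>
     (\<forall>k. Psi h p A c \<sigma> x k (y (Suc k), z (Suc k)) - (INF w. Psi h p A c \<sigma> x k w)
            \<le> ereal ((\<epsilon> k)\<^sup>2 / (2 * \<sigma> k)))"

definition stop_B1 ::
  "('b::euclidean_space \<Rightarrow> real) \<Rightarrow> ('a::euclidean_space \<Rightarrow> ereal) \<Rightarrow> ('a \<Rightarrow> 'b) \<Rightarrow> 'a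
     \<Rightarrow> (nat \<Rightarrow> real) \<Rightarrow> (nat \<Rightarrow> 'b) \<Rightarrow> (nat \<Rightarrow> 'a) \<Rightarrow> (nat \<Rightarrow> 'a) \<Rightarrow> (nat \<Rightarrow> real) \<Rightarrow> bool" where
  "stop_B1 h p A c \<sigma> y z x \<delta> \<longleftrightarrow>
     (\<forall>k. \<delta> k \<ge> 0) \<and> summable \<delta> \<and>
     (\<forall>k. Psi h p A c \<sigma> x k (y (Suc k), z (Suc k)) - (INF w. Psi h p A c \<sigma> x k w)
            \<le> ereal ((\<delta> k)\<^sup>2 / (2 * \<sigma> k) * (norm (x (Suc k) - x k))\<^sup>2))"

definition stop_B2 ::
  "('b::euclidean_space \<Rightarrow> real) \<Rightarrow> ('a::euclidean_space \<Rightarrow> ereal) \<Rightarrow> ('a \<Rightarrow> 'b) \<Rightarrow> 'a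
     \<Rightarrow> (nat \<Rightarrow> real) \<Rightarrow> (nat \<Rightarrow> 'b) \<Rightarrow> (nat \<Rightarrow> 'a) \<Rightarrow> (nat \<Rightarrow> 'a) \<Rightarrow> (nat \<Rightarrow> real) \<Rightarrow> bool" where
  "stop_B2 h p A c \<sigma> y z x \<delta>' \<longleftrightarrow>
     (\<forall>k. \<delta>' k \<ge> 0) \<and> \<delta>' \<longlonglongrightarrow> 0 \<and>
     (\<forall>k. set_dist 0 (subdiff (Psi h p A c \<sigma> x k) (y (Suc k), z (Suc k)))
            \<le> ereal (\<delta>' k / \<sigma> k * norm (x (Suc k) - x k)))"

section \<open>Convergence rates\<close>

definition rate :: "real \<Rightarrow> (nat \<Rightarrow> real) \<Rightarrow> (nat \<Rightarrow> real) \<Rightarrow> nat \<Rightarrow> real" where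
  "rate a \<sigma> \<delta> k = (a * (a\<^sup>2 + (\<sigma> k)\<^sup>2) powr (- 1/2) + 2 * \<delta> k) * inverse (1 - \<delta> k)"

definition rate_inf :: "real \<Rightarrow> ereal \<Rightarrow> real" where
  "rate_inf a \<sigma>_inf =
     (if \<sigma>_inf = \<infinity> then 0 else a * (a\<^sup>2 + (real_of_ereal \<sigma>_inf)\<^sup>2) powr (- 1/2))"

definition rate' :: "real \<Rightarrow> (nat \<Rightarrow> real) \<Rightarrow> (nat \<Rightarrow> real) \<Rightarrow> nat \<Rightarrow> real" where
  "rate' a \<sigma> \<delta>' k = a * (1 + \<delta>' k) / \<sigma> k"

definition rate'_inf :: "real \<Rightarrow> ereal \<Rightarrow> real" where
  "rate'_inf a \<sigma>_inf = (if \<sigma>_inf = \<infinity> then 0 else a / real_of_ereal \<sigma>_inf)"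

end

theory Submission
  imports Defs
begin

text \<open>
The augmented Lagrangian method for the dual is the proximal point method for the primal in disguise,
and everything rests on one quantitative form of this fact. Let \<open>P\<close> be the proximal point of \<open>x k\<close> with
parameter \<open>\<sigma> k\<close>. Smoothness of \<open>h\<close> makes its optimality condition explicit: it displays a dual pair
whose augmented Lagrangian value is minus the optimal value of the proximal subproblem. Subtracting this
value from the augmented Lagrangian at an arbitrary \<open>(y, z)\<close> leaves a sum of three nonnegative terms: the
Fenchel--Young gap of \<open>h\<close> at \<open>(y, A P)\<close>, that of \<open>p\<close> at \<open>(z, P)\<close>, and
\<open>(norm (x (Suc k) - P))\<^sup>2 / (2 * \<sigma> k)\<close>, where \<open>x (Suc k)\<close> is the multiplier update. Since the infimum
is at most the subtracted value, each of the three terms is bounded by the optimality gap of \<open>(y, z)\<close>. This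
is \<open>augmented_lagrangian_gap\<close>.

Consequently the stopping criteria bound the distance from \<open>x (Suc k)\<close> to the proximal point. The criterion
\<open>stop_A\<close> makes the errors summable, and as proximal steps decrease the distance to every solution
(\<open>prox_firm\<close>), \<open>quasi_fejer_convergence\<close> gives convergence of \<open>x\<close>. The criterion \<open>stop_B1\<close> makes the errors small
relative to the step, and the error bound on the subdifferential turns the Pythagorean decrease into a
contraction of the distance to the solution set (\<open>inexact_proximal_contraction\<close>).

On the dual side the gradient of \<open>h\<close> at \<open>A w\<close>, for any primal solution \<open>w\<close>, is the \<open>y\<close>-part of the
only dual solution. A Lipschitz gradient makes the Fenchel--Young gap of \<open>h\<close> dominate a multiple of the
squared distance of \<open>y\<close> from the gradient (\<open>fenchel_young_gap\<close>); this yields uniqueness, and because the same gap occurs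
above, also convergence of \<open>y\<close> and then of \<open>z\<close>. Local strong convexity of \<open>h\<close> places the limit in the
interior of the domain of the conjugate (\<open>interior_effdom_conjugate\<close>).

For the last estimate, a subgradient of the augmented Lagrangian at the new iterate, together with the
constraint residual, is an element of \<open>T_l\<close> there (\<open>subgradient_shift_multiplier\<close>). The criterion \<open>stop_B2\<close>
bounds its norm by \<open>(1 + \<delta>' k) / \<sigma> k * norm (x (Suc k) - x k)\<close>, and every zero of \<open>T_l\<close> has the dual solution
as its first two components, so metric subregularity bounds the dual error as claimed.
\<close>

section \<open>Smooth convex functions\<close>

lemma norm_add_scaleR_squared:
  fixes a d :: "'a::real_inner"
  shows "(norm (a + t *\<^sub>R d))\<^sup>2 = (norm a)\<^sup>2 + 2 * t * (a \<bullet> d) + t\<^sup>2 * (norm d)\<^sup>2"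
  unfolding power2_norm_eq_inner
  by (simp add: inner_simps inner_commute[of d a] power2_eq_square algebra_simps)

text \<open>Restricting \<open>h\<close> to the line through \<open>u\<close> and \<open>v\<close> reduces this to the one-dimensional tangent inequality.\<close>

lemma convex_gradient_inequality:
  fixes h :: "'a::real_inner \<Rightarrow> real"
  assumes conv: "convex_on UNIV h" and grad: "GDERIV h u :> g"
  shows "h u + g \<bullet> (v - u) \<le> h v"
proof -
  define \<phi> where "\<phi> t = h (u + t *\<^sub>R (v - u))" for t :: real
  have "convex_on UNIV \<phi>"
  proof (rule convex_onI)
    fix t s r :: real assume t: "0 < t" "t < 1"
    have "u + ((1 - t) *\<^sub>R s + t *\<^sub>R r) *\<^sub>R (v - u)
        = (1 - t) *\<^sub>R (u + s *\<^sub>R (v - u)) + t *\<^sub>R (u + r *\<^sub>R (v - u))"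
      by (simp add: algebra_simps)
    then show "\<phi> ((1 - t) *\<^sub>R s + t *\<^sub>R r) \<le> (1 - t) * \<phi> s + t * \<phi> r"
      using convex_onD[OF conv, of t] t by (simp add: \<phi>_def)
  qed simp
  moreover have "(\<phi> has_field_derivative (g \<bullet> (v - u))) (at 0)"
  proof -
    have h: "(h has_derivative (\<lambda>d. d \<bullet> g)) (at (u + 0 *\<^sub>R (v - u)))"
      using grad by (simp add: gderiv_def)
    have "(\<phi> has_derivative (\<lambda>t. (t *\<^sub>R (v - u)) \<bullet> g)) (at 0)"
      unfolding \<phi>_def using h by (rule has_derivative_compose[rotated, where g = h]) (auto intro!: derivative_eq_intros)
    then show ?thesis
      unfolding has_field_derivative_def
      by (rule has_derivative_eq_rhs) (auto simp: inner_commute)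
  qed
  ultimately have "\<phi> 1 - \<phi> 0 \<ge> g \<bullet> (v - u) * (1 - 0)"
    by (intro convex_on_imp_above_tangent[where A = UNIV]) auto
  then show ?thesis by (simp add: \<phi>_def)
qed

text \<open>The gradient inequality at \<open>v\<close> bounds \<open>h v - h u\<close> by \<open>G v \<bullet> (v - u)\<close>; exchanging \<open>G v\<close> for \<open>G u\<close> costs at
most \<open>L * (norm (v - u))\<^sup>2\<close>, twice the classical error term.\<close>

lemma convex_descent_inequality:
  fixes h :: "'a::real_inner \<Rightarrow> real"
  assumes "convex_on UNIV h" and grad: "\<And>u. GDERIV h u :> G u" and lip: "L-lipschitz_on UNIV G"
  shows "h v \<le> h u + G u \<bullet> (v - u) + L * (norm (v - u))\<^sup>2"
proof -
  have "h v + G v \<bullet> (u - v) \<le> h u"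
    by (rule convex_gradient_inequality[OF assms(1) grad])
  then have "h v \<le> h u + G u \<bullet> (v - u) + (G v - G u) \<bullet> (v - u)"
    by (simp add: inner_simps)
  moreover have "(G v - G u) \<bullet> (v - u) \<le> norm (G v - G u) * norm (v - u)"
    by (rule norm_cauchy_schwarz)
  moreover have "\<dots> \<le> (L * norm (v - u)) * norm (v - u)"
    using lipschitz_onD[OF lip, of v u] by (intro mult_right_mono) (auto simp: dist_norm)
  ultimately show ?thesis by (simp add: power2_eq_square)
qed

section \<open>Conjugates and first-order conditions\<close>

lemma conjugate_ge: "ereal (v \<bullet> u) - f u \<le> conjugate f v"
  unfolding conjugate_def by (rule SUP_upper) simp

lemma conjugate_neq_minus_infinity:
  assumes "proper_fun f" shows "conjugate f v \<noteq> -\<infinity>"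
proof -
  obtain u where "f u \<noteq> \<infinity>" "f u \<noteq> -\<infinity>"
    using assms by (auto simp: proper_fun_def effdom_def)
  then show ?thesis using conjugate_ge[of v u f] by (cases "f u") auto
qed

lemma proper_fun_real: "proper_fun (\<lambda>u. ereal (h u))"
  by (simp add: proper_fun_def effdom_def)

lemma conjugate_at_subgradient:
  assumes "v \<in> subdiff f u" and "f u = ereal a"
  shows "conjugate f v = ereal (v \<bullet> u - a)"
proof (rule antisym)
  show "conjugate f v \<le> ereal (v \<bullet> u - a)"
    unfolding conjugate_def
  proof (rule SUP_least)
    fix w
    have "ereal (a + v \<bullet> (w - u)) \<le> f w"
      using assms by (auto simp: subdiff_def)
    then show "ereal (v \<bullet> w) - f w \<le> ereal (v \<bullet> u - a)"
      by (cases "f w") (auto simp: inner_simps)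
  qed
  show "ereal (v \<bullet> u - a) \<le> conjugate f v"
    using conjugate_ge[of v u f] assms(2) by simp
qed

text \<open>Convexity stated for pairs of points with finite values. For functions without the value \<open>-\<infinity>\<close> this is
convexity of the epigraph, but it passes to conjugates and to separable sums on a product space by
direct computation.\<close>

definition segment_convex :: "('a::real_vector \<Rightarrow> ereal) \<Rightarrow> bool" where
  "segment_convex f \<longleftrightarrow>
     (\<forall>u v a b t. f u = ereal a \<longrightarrow> f v = ereal b \<longrightarrow> 0 < t \<longrightarrow> t < 1 \<longrightarrow>
        f (u + t *\<^sub>R (v - u)) \<le> ereal ((1 - t) * a + t * b))"

lemma closed_proper_convex_imp_segment_convex:
  assumes "closed_proper_convex f" shows "segment_convex f"
  unfolding segment_convex_def
proof (intro allI impI)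
  fix u v a b and t :: real
  assume *: "f u = ereal a" "f v = ereal b" "0 < t" "t < 1"
  have "(1 - t) *\<^sub>R (u, a) + t *\<^sub>R (v, b) \<in> ereal_epigraph f"
    using assms * by (intro convexD) (auto simp: closed_proper_convex_def ereal_epigraph_def)
  moreover have "(1 - t) *\<^sub>R u + t *\<^sub>R v = u + t *\<^sub>R (v - u)"
    by (simp add: algebra_simps)
  ultimately show "f (u + t *\<^sub>R (v - u)) \<le> ereal ((1 - t) * a + t * b)"
    by (simp add: ereal_epigraph_def)
qed

lemma conjugate_segment_convex:
  assumes "proper_fun f" shows "segment_convex (conjugate f)"
  unfolding segment_convex_def
proof (intro allI impI)
  fix u v a b and t :: real
  assume *: "conjugate f u = ereal a" "conjugate f v = ereal b" "0 < t" "t < 1"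
  show "conjugate f (u + t *\<^sub>R (v - u)) \<le> ereal ((1 - t) * a + t * b)"
    unfolding conjugate_def
  proof (rule SUP_least)
    fix w
    show "ereal ((u + t *\<^sub>R (v - u)) \<bullet> w) - f w \<le> ereal ((1 - t) * a + t * b)"
    proof (cases "f w")
      case (real r)
      have "u \<bullet> w - r \<le> a" "v \<bullet> w - r \<le> b"
        using conjugate_ge[of u w f] conjugate_ge[of v w f] * real by auto
      then have "(1 - t) * (u \<bullet> w - r) + t * (v \<bullet> w - r) \<le> (1 - t) * a + t * b"
        using * by (intro add_mono mult_left_mono) auto
      then show ?thesis using real by (simp add: inner_simps algebra_simps)
    qed (use assms in \<open>auto simp: proper_fun_def\<close>)
  qed
qed

lemma segment_convex_sum:
  assumes "segment_convex f" "segment_convex g"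
    and nf: "\<And>u. f u \<noteq> -\<infinity>" and ng: "\<And>w. g w \<noteq> -\<infinity>"
  shows "segment_convex (\<lambda>(u, w). f u + g w)"
  unfolding segment_convex_def
proof (clarsimp)
  fix u w u' w' a b and t :: real
  assume *: "f u + g w = ereal a" "f u' + g w' = ereal b" "0 < t" "t < 1"
  obtain a1 a2 where a: "f u = ereal a1" "g w = ereal a2" "a = a1 + a2"
    using *(1) nf[of u] ng[of w] by (cases "f u"; cases "g w") auto
  obtain b1 b2 where b: "f u' = ereal b1" "g w' = ereal b2" "b = b1 + b2"
    using *(2) nf[of u'] ng[of w'] by (cases "f u'"; cases "g w'") auto
  have "f (u + t *\<^sub>R (u' - u)) \<le> ereal ((1 - t) * a1 + t * b1)"
    and "g (w + t *\<^sub>R (w' - w)) \<le> ereal ((1 - t) * a2 + t * b2)"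
    using assms(1,2) a b * unfolding segment_convex_def by blast+
  from add_mono[OF this] show "f (u + t *\<^sub>R (u' - u)) + g (w + t *\<^sub>R (w' - w)) \<le> ereal ((1 - t) * a + t * b)"
    by (simp add: a b algebra_simps)
qed

text \<open>If \<open>P\<close> minimises \<open>q + \<phi>\<close>, moving from \<open>P\<close> a fraction \<open>t\<close> of the way towards \<open>u\<close> changes \<open>\<phi>\<close> by at
most \<open>t * (\<phi> u - \<phi> P)\<close> and \<open>q\<close> by \<open>t * (g \<bullet> (u - P))\<close> up to second order; divide by \<open>t\<close> and let \<open>t\<close>
tend to \<open>0\<close>. The form of the bound on \<open>q\<close> is shared by \<open>h \<circ> A\<close>, by proximal terms and by the quadratic
penalty.\<close>

lemma first_order_condition:
  fixes \<phi> :: "'a::real_inner \<Rightarrow> ereal" and q :: "'a \<Rightarrow> real"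
  assumes conv: "segment_convex \<phi>" and nmi: "\<And>u. \<phi> u \<noteq> -\<infinity>"
    and P: "\<phi> P = ereal a"
    and min: "\<And>u. ereal (q P) + \<phi> P \<le> ereal (q u) + \<phi> u"
    and upper: "\<And>d t. 0 < t \<Longrightarrow> t < 1 \<Longrightarrow> q (P + t *\<^sub>R d) \<le> q P + t * (g \<bullet> d) + t\<^sup>2 * C d"
  shows "- g \<in> subdiff \<phi> P"
proof (clarsimp simp: subdiff_def P)
  fix u
  show "ereal (a - g \<bullet> (u - P)) \<le> \<phi> u"
  proof (cases "\<phi> u")
    case (real b)
    let ?d = "u - P"
    have le: "a - b - g \<bullet> ?d \<le> t * C ?d" if t: "0 < t" "t < 1" for t
    proof -
      have "\<phi> (P + t *\<^sub>R ?d) \<le> ereal ((1 - t) * a + t * b)"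
        using conv P real t unfolding segment_convex_def by blast
      then have "ereal (q P) + \<phi> P \<le> ereal (q (P + t *\<^sub>R ?d)) + ereal ((1 - t) * a + t * b)"
        using min[of "P + t *\<^sub>R ?d"] by (meson add_left_mono order_trans)
      then have "q P + a \<le> q P + t * (g \<bullet> ?d) + t\<^sup>2 * C ?d + (1 - t) * a + t * b"
        using upper[OF t, of ?d] P by auto
      then have "t * (a - b - g \<bullet> ?d) \<le> t * (t * C ?d)"
        by (simp add: algebra_simps power2_eq_square)
      then show ?thesis using t by simp
    qed
    have "((\<lambda>t. t * C ?d) \<longlongrightarrow> 0 * C ?d) (at_right 0)"
      by (intro tendsto_intros)
    moreover have "eventually (\<lambda>t. a - b - g \<bullet> ?d \<le> t * C ?d) (at_right (0::real))"
      by (rule eventually_mono[OF eventually_at_right_real[of 0 1]]) (auto intro: le)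
    ultimately have "a - b - g \<bullet> ?d \<le> 0"
      using tendsto_lowerbound[of "\<lambda>t. t * C ?d" 0 "at_right 0" "a - b - g \<bullet> ?d"] by simp
    then show ?thesis using real by simp
  qed (use nmi in auto)
qed

text \<open>The Fenchel--Young gap of \<open>(v, u)\<close> controls the distance of \<open>v\<close> from the gradient at \<open>u\<close>: this is how
a small duality gap forces convergence of the dual iterates. The conjugate is bounded below by its
value at the test point \<open>u + (v - G u) / (2 * L)\<close>, which maximises the lower bound that the descent
inequality provides.\<close>

lemma fenchel_young_gap:
  fixes h :: "'a::real_inner \<Rightarrow> real"
  assumes "convex_on UNIV h" "\<And>u. GDERIV h u :> G u" "L-lipschitz_on UNIV G" and L: "L > 0"
  shows "ereal (v \<bullet> u - h u + (norm (v - G u))\<^sup>2 / (4 * L)) \<le> conjugate (\<lambda>u. ereal (h u)) v"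
proof -
  define d where "d = v - G u"
  define w where "w = u + (1 / (2 * L)) *\<^sub>R d"
  have "h w \<le> h u + G u \<bullet> (w - u) + L * (norm (w - u))\<^sup>2"
    by (rule convex_descent_inequality[OF assms(1-3)])
  also have "\<dots> = h u + G u \<bullet> d / (2 * L) + (norm d)\<^sup>2 / (4 * L)"
    using L by (simp add: w_def power_mult_distrib power_divide power2_eq_square)
  finally have "h w \<le> h u + G u \<bullet> d / (2 * L) + (norm d)\<^sup>2 / (4 * L)" .
  moreover have "v \<bullet> w = v \<bullet> u + v \<bullet> d / (2 * L)"
    by (simp add: w_def inner_simps)
  moreover have "v \<bullet> d / (2 * L) - G u \<bullet> d / (2 * L) = 2 * ((norm d)\<^sup>2 / (4 * L))"
  proof -
    have "v \<bullet> d - G u \<bullet> d = (norm d)\<^sup>2"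
      by (simp add: d_def power2_norm_eq_inner inner_diff_left)
    then show ?thesis by (simp add: diff_divide_distrib[symmetric])
  qed
  ultimately have "v \<bullet> u - h u + (norm d)\<^sup>2 / (4 * L) \<le> v \<bullet> w - h w"
    by linarith
  then show ?thesis
    using conjugate_ge[of v w "\<lambda>u. ereal (h u)"] by (auto simp: d_def elim: order_trans[rotated])
qed

text \<open>Strong convexity on the unit ball around \<open>u0\<close> lifts \<open>h\<close> above its tangent at \<open>u0\<close> by a fixed amount on
the unit sphere; convexity propagates this outwards to growth at a linear rate. Hence tilting the
tangent slope by less than that rate keeps the conjugate finite.\<close>

lemma interior_effdom_conjugate:
  fixes h :: "'a::euclidean_space \<Rightarrow> real"
  assumes conv: "convex_on UNIV h" and grad: "\<And>u. GDERIV h u :> G u"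
    and elsc: "ess_locally_strongly_convex (\<lambda>u. ereal (h u))"
  shows "G u0 \<in> interior (effdom (conjugate (\<lambda>u. ereal (h u))))"
proof -
  have tang: "h u + G u \<bullet> (v - u) \<le> h v" for u v
    by (rule convex_gradient_inequality[OF conv grad])
  have "cball u0 1 \<subseteq> {u. subdiff (\<lambda>u. ereal (h u)) u \<noteq> {}}"
    using tang by (auto simp: subdiff_def)
  moreover have "compact (cball u0 1)" "convex (cball u0 1)" by auto
  ultimately obtain \<beta> where \<beta>: "\<beta> > 0" and strong: "\<forall>y'\<in>cball u0 1. \<forall>y\<in>cball u0 1. \<forall>t\<in>{0..1}.
      ereal (1 - t) * ereal (h y') + ereal t * ereal (h y)
        \<ge> ereal (h ((1 - t) *\<^sub>R y' + t *\<^sub>R y)) + ereal (1/2 * \<beta> * t * (1 - t) * (norm (y' - y))\<^sup>2)"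
    using elsc unfolding ess_locally_strongly_convex_def by metis
  have sphere: "h u0 + G u0 \<bullet> e + \<beta> / 4 \<le> h (u0 + e)" if e: "norm e = 1" for e
  proof -
    have "ereal (1 - 1/2) * ereal (h u0) + ereal (1/2) * ereal (h (u0 + e))
        \<ge> ereal (h ((1 - 1/2) *\<^sub>R u0 + (1/2) *\<^sub>R (u0 + e)))
          + ereal (1/2 * \<beta> * (1/2) * (1 - 1/2) * (norm (u0 - (u0 + e)))\<^sup>2)"
      using strong[rule_format, of u0 "u0 + e" "1/2"] e by (simp add: dist_norm)
    moreover have "(1 - 1/2) *\<^sub>R u0 + (1/2) *\<^sub>R (u0 + e) = u0 + (1/2) *\<^sub>R e"
      by (simp add: algebra_simps flip: scaleR_add_left)
    ultimately have "h (u0 + (1/2) *\<^sub>R e) + \<beta> / 8 \<le> 1/2 * h u0 + 1/2 * h (u0 + e)"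
      using e by simp
    moreover have "h u0 + G u0 \<bullet> e / 2 \<le> h (u0 + (1/2) *\<^sub>R e)"
      using tang[of u0 "u0 + (1/2) *\<^sub>R e"] by simp
    ultimately show ?thesis by (simp add: field_simps)
  qed
  \<comment> \<open>Scale the point back to the unit sphere and use convexity along the ray.\<close>
  have growth: "h u0 + G u0 \<bullet> d + \<beta> / 4 * norm d \<le> h (u0 + d)" if d: "norm d \<ge> 1" for d
  proof -
    define n e where "n = norm d" and "e = (1 / norm d) *\<^sub>R d"
    have n: "n \<ge> 1" and e: "norm e = 1" and de: "d = n *\<^sub>R e"
      using d by (auto simp: n_def e_def)
    have "u0 + e = (1 - 1 / n) *\<^sub>R u0 + (1 / n) *\<^sub>R (u0 + d)"
      using n by (simp add: de algebra_simps)
    then have "h (u0 + e) \<le> (1 - 1 / n) * h u0 + (1 / n) * h (u0 + d)"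
      using convex_onD[OF conv, of "1 / n" u0 "u0 + d"] n by simp
    with sphere[OF e] have "n * (G u0 \<bullet> e + \<beta> / 4) \<le> n * ((1 / n) * (h (u0 + d) - h u0))"
      using n by (intro mult_left_mono) (auto simp: algebra_simps)
    then show ?thesis using n by (simp add: de e algebra_simps)
  qed
  have "ball (G u0) (\<beta> / 4) \<subseteq> effdom (conjugate (\<lambda>u. ereal (h u)))"
  proof
    fix v assume "v \<in> ball (G u0) (\<beta> / 4)"
    then have v: "norm (v - G u0) \<le> \<beta> / 4" by (simp add: dist_norm norm_minus_commute)
    have "conjugate (\<lambda>u. ereal (h u)) v \<le> ereal (v \<bullet> u0 - h u0 + \<beta> / 4)"
      unfolding conjugate_def
    proof (rule SUP_least)
      fix u
      define d where "d = u - u0"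
      have u: "u = u0 + d" by (simp add: d_def)
      have cs: "(v - G u0) \<bullet> d \<le> \<beta> / 4 * norm d"
        using norm_cauchy_schwarz[of "v - G u0" d] mult_right_mono[OF v norm_ge_zero[of d]]
        by linarith
      have "v \<bullet> d + h u0 - h u \<le> \<beta> / 4"
      proof (cases "norm d \<ge> 1")
        case True
        then show ?thesis using growth[OF True] cs \<beta> by (simp add: u inner_simps)
      next
        case False
        then have "\<beta> / 4 * norm d \<le> \<beta> / 4 * 1" using \<beta> by (intro mult_left_mono) auto
        then show ?thesis using tang[of u0 u] cs by (simp add: u inner_simps)
      qed
      then show "ereal (v \<bullet> u) - ereal (h u) \<le> ereal (v \<bullet> u0 - h u0 + \<beta> / 4)"
        by (simp add: u inner_simps)
    qed
    then show "v \<in> effdom (conjugate (\<lambda>u. ereal (h u)))"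
      by (auto simp: effdom_def intro: le_less_trans)
  qed
  moreover have "\<beta> / 4 > 0" using \<beta> by simp
  ultimately show ?thesis unfolding mem_interior by blast
qed

section \<open>Approximate proximal point sequences\<close>

text \<open>Subtracting the partial sums of \<open>\<epsilon>\<close> makes the sequence decreasing.\<close>

lemma almost_decreasing_convergent:
  fixes a \<epsilon> :: "nat \<Rightarrow> real"
  assumes "\<And>k. a k \<ge> 0" "summable \<epsilon>" "\<And>k. \<epsilon> k \<ge> 0" "\<And>k. a (Suc k) \<le> a k + \<epsilon> k"
  shows "convergent a"
proof -
  define b where "b k = a k - (\<Sum>i<k. \<epsilon> i)" for k
  have "decseq b" by (rule decseq_SucI) (use assms(4) in \<open>simp add: b_def algebra_simps\<close>)
  moreover have "- suminf \<epsilon> \<le> b k" for k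
    using sum_le_suminf[OF assms(2), of "{..<k}"] assms(1)[of k] assms(3) by (simp add: b_def)
  ultimately obtain l where "b \<longlonglongrightarrow> l" using decseq_convergent by metis
  from tendsto_add[OF this summable_LIMSEQ[OF assms(2)]]
  have "a \<longlonglongrightarrow> l + suminf \<epsilon>" by (simp add: b_def)
  then show ?thesis by (rule convergentI)
qed

text \<open>The convergence argument for the inexact proximal point algorithm. The exact step moves \<open>x k\<close> away
from no point of \<open>S\<close> and the inexactness is summable, so the distance to each fixed \<open>w \<in> S\<close>
converges. The steps therefore tend to \<open>0\<close>, some cluster point lies in \<open>S\<close>, and the distance to that
point, having a limit and vanishing along a subsequence, tends to \<open>0\<close>.\<close>

lemma quasi_fejer_convergence:
  fixes x P :: "nat \<Rightarrow> 'a::euclidean_space"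
  assumes ne: "S \<noteq> {}"
    and eps: "summable \<epsilon>" "\<And>k. \<epsilon> k \<ge> 0"
    and near: "\<And>k. norm (x (Suc k) - P k) \<le> \<epsilon> k"
    and firm: "\<And>k w. w \<in> S \<Longrightarrow> (norm (x k - P k))\<^sup>2 + (norm (P k - w))\<^sup>2 \<le> (norm (x k - w))\<^sup>2"
    and cluster: "\<And>r l. strict_mono r \<Longrightarrow> (\<lambda>k. x (r k)) \<longlonglongrightarrow> l \<Longrightarrow> (\<lambda>k. P (r k)) \<longlonglongrightarrow> l
        \<Longrightarrow> (\<lambda>k. x (r k) - P (r k)) \<longlonglongrightarrow> 0 \<Longrightarrow> l \<in> S"
  shows "\<exists>l\<in>S. x \<longlonglongrightarrow> l \<and> P \<longlonglongrightarrow> l"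
proof -
  have eps0: "\<epsilon> \<longlonglongrightarrow> 0" by (rule summable_LIMSEQ_zero[OF eps(1)])
  have closer: "norm (P k - w) \<le> norm (x k - w)" if "w \<in> S" for k w
    using firm[OF that, of k] zero_le_power2[of "norm (x k - P k)"]
    by (intro power2_le_imp_le[of "norm (P k - w)"]) (linarith, simp)
  have step: "norm (x (Suc k) - w) \<le> norm (P k - w) + \<epsilon> k" for k w
    using norm_triangle_ineq[of "x (Suc k) - P k" "P k - w"] near[of k] by simp
  have conv: "convergent (\<lambda>k. norm (x k - w))" if "w \<in> S" for w
  proof (rule almost_decreasing_convergent[OF _ eps])
    show "norm (x (Suc k) - w) \<le> norm (x k - w) + \<epsilon> k" for k
      using closer[OF that, of k] step[of k w] by linarith
  qed simp
  obtain w where w: "w \<in> S" using ne by blast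
  then obtain m where m: "(\<lambda>k. norm (x k - w)) \<longlonglongrightarrow> m"
    using conv by (auto simp: convergent_def)
  have Pm: "(\<lambda>k. norm (P k - w)) \<longlonglongrightarrow> m"
  proof (rule tendsto_sandwich)
    show "(\<lambda>k. norm (x (Suc k) - w) - \<epsilon> k) \<longlonglongrightarrow> m"
      using tendsto_diff[OF LIMSEQ_Suc[OF m] eps0] by simp
    show "\<forall>\<^sub>F k in sequentially. norm (x (Suc k) - w) - \<epsilon> k \<le> norm (P k - w)"
      using step[of _ w] by (intro always_eventually) (auto simp: algebra_simps)
    show "\<forall>\<^sub>F k in sequentially. norm (P k - w) \<le> norm (x k - w)"
      using closer[OF w] by simp
  qed (rule m)
  have "(\<lambda>k. (norm (x k - P k))\<^sup>2) \<longlonglongrightarrow> 0"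
  proof (rule tendsto_sandwich[OF _ _ tendsto_const])
    show "(\<lambda>k. (norm (x k - w))\<^sup>2 - (norm (P k - w))\<^sup>2) \<longlonglongrightarrow> 0"
      using tendsto_diff[OF tendsto_power[OF m, of 2] tendsto_power[OF Pm, of 2]] by simp
    show "\<forall>\<^sub>F k in sequentially. (norm (x k - P k))\<^sup>2 \<le> (norm (x k - w))\<^sup>2 - (norm (P k - w))\<^sup>2"
      using firm[OF w] by (intro always_eventually) (auto simp: algebra_simps)
  qed auto
  then have diff: "(\<lambda>k. x k - P k) \<longlonglongrightarrow> 0"
    by (simp add: tendsto_norm_zero_iff)
  have "bounded (range x)"
  proof -
    obtain K where "\<And>k. norm (norm (x k - w)) \<le> K"
      using convergent_imp_Bseq[OF conv[OF w]] by (auto simp: Bseq_def)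
    then have "range x \<subseteq> cball w K" by (auto simp: dist_norm norm_minus_commute)
    then show ?thesis using bounded_cball bounded_subset by blast
  qed
  then obtain l r where r: "strict_mono r" "(x \<circ> r) \<longlonglongrightarrow> l"
    using bounded_imp_convergent_subsequence by blast
  then have xr: "(\<lambda>k. x (r k)) \<longlonglongrightarrow> l" by (simp add: comp_def)
  have dr: "(\<lambda>k. x (r k) - P (r k)) \<longlonglongrightarrow> 0"
    using LIMSEQ_subseq_LIMSEQ[OF diff r(1)] by (simp add: comp_def)
  have l: "l \<in> S"
    using cluster[OF r(1) xr _ dr] tendsto_diff[OF xr dr] by simp
  then obtain m' where m': "(\<lambda>k. norm (x k - l)) \<longlonglongrightarrow> m'"
    using conv by (auto simp: convergent_def)
  have "(\<lambda>k. norm (x (r k) - l)) \<longlonglongrightarrow> m'"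
    using LIMSEQ_subseq_LIMSEQ[OF m' r(1)] by (simp add: comp_def)
  moreover have "(\<lambda>k. norm (x (r k) - l)) \<longlonglongrightarrow> 0"
    using xr by (simp add: LIM_zero_iff tendsto_norm_zero_iff)
  ultimately have "m' = 0" by (rule LIMSEQ_unique)
  with m' have x: "x \<longlonglongrightarrow> l" by (simp add: LIM_zero_iff tendsto_norm_zero_iff)
  then show ?thesis using l tendsto_diff[OF x diff] by auto
qed

lemma set_dist_eq_infdist:
  assumes "S \<noteq> {}" shows "set_dist u S = ereal (infdist u S)"
proof (rule antisym)
  show "ereal (infdist u S) \<le> set_dist u S"
    unfolding set_dist_def by (intro INF_greatest) (auto simp: dist_norm[symmetric] infdist_le)
  show "set_dist u S \<le> ereal (infdist u S)"
  proof (rule ereal_le_epsilon2)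
    fix e :: real assume e: "e > 0"
    have "\<exists>w\<in>S. dist u w < infdist u S + e"
      using cINF_less_iff[of S "dist u" "infdist u S + e"] assms e by (simp add: infdist_notempty)
    then obtain w where w: "w \<in> S" "dist u w < infdist u S + e" by blast
    have "set_dist u S \<le> ereal (dist u w)"
      unfolding set_dist_def dist_norm by (rule INF_lower[OF w(1)])
    then show "set_dist u S \<le> ereal (infdist u S) + ereal e"
      by (rule order_trans) (use w(2) in simp)
  qed
qed

lemma infdist_proximal_decrease:
  assumes ne: "S \<noteq> {}"
    and firm: "\<And>w. w \<in> S \<Longrightarrow> (norm (x - P))\<^sup>2 + (norm (P - w))\<^sup>2 \<le> (norm (x - w))\<^sup>2"
  shows "(norm (x - P))\<^sup>2 + (infdist P S)\<^sup>2 \<le> (infdist x S)\<^sup>2"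
proof -
  have "sqrt ((norm (x - P))\<^sup>2 + (infdist P S)\<^sup>2) \<le> infdist x S"
    unfolding infdist_notempty[OF ne, of x]
  proof (rule cINF_greatest[OF ne])
    fix w assume w: "w \<in> S"
    have "(infdist P S)\<^sup>2 \<le> (norm (P - w))\<^sup>2"
      using infdist_le[OF w, of P] by (intro power_mono) (auto simp: dist_norm infdist_nonneg)
    then show "sqrt ((norm (x - P))\<^sup>2 + (infdist P S)\<^sup>2) \<le> dist x w"
      using firm[OF w] by (intro real_le_lsqrt) (auto simp: dist_norm)
  qed
  then show ?thesis by (rule sqrt_le_D)
qed

lemma powr_minus_half_eq:
  fixes r :: real
  assumes "r > 0" shows "r powr (- 1/2) = 1 / sqrt r"
proof -
  have "r powr (- 1/2) = r powr (- (1/2))" by simp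
  also have "\<dots> = inverse (r powr (1/2))" by (rule powr_minus)
  also have "\<dots> = 1 / sqrt r" using assms by (simp add: powr_half_sqrt inverse_eq_divide)
  finally show ?thesis .
qed

text \<open>For the exact proximal point \<open>P\<close>, the error bound compares \<open>infdist P S\<close> with the step length
\<open>norm (x - P)\<close>, and the Pythagorean decrease bounds that step by what has been gained in distance;
eliminating the step gives the factor \<open>a / sqrt (a\<^sup>2 + s\<^sup>2)\<close>. The relative error criterion bounds
\<open>norm (x' - x)\<close> by \<open>infdist x S / (1 - \<delta>)\<close>, so that replacing \<open>P\<close> by \<open>x'\<close> costs
\<open>\<delta> / (1 - \<delta>)\<close>.\<close>

lemma inexact_proximal_contraction:
  assumes "s > 0" "a \<ge> 0" "0 \<le> \<delta>" "\<delta> < 1"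
    and decrease: "(norm (x - P))\<^sup>2 + (infdist P S)\<^sup>2 \<le> (infdist x S)\<^sup>2"
    and error: "infdist P S \<le> a * (norm (x - P) / s)"
    and near: "norm (x' - P) \<le> \<delta> * norm (x' - x)"
  shows "infdist x' S \<le> (a * (a\<^sup>2 + s\<^sup>2) powr (- 1/2) + 2 * \<delta>) * inverse (1 - \<delta>) * infdist x S"
proof -
  define D where "D = infdist x S"
  define \<mu> where "\<mu> = a * (a\<^sup>2 + s\<^sup>2) powr (- 1/2)"
  have D: "D \<ge> 0" by (simp add: D_def infdist_nonneg)
  have pos: "a\<^sup>2 + s\<^sup>2 > 0" using \<open>s > 0\<close> by (simp add: add_nonneg_pos)
  have mu: "\<mu> = a / sqrt (a\<^sup>2 + s\<^sup>2)"
    unfolding \<mu>_def powr_minus_half_eq[OF pos] by simp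
  have mu0: "\<mu> \<ge> 0" using \<open>a \<ge> 0\<close> by (simp add: \<mu>_def)
  have "(s * infdist P S)\<^sup>2 \<le> (a * norm (x - P))\<^sup>2"
  proof (rule power_mono)
    show "s * infdist P S \<le> a * norm (x - P)"
      using mult_left_mono[OF error, of s] \<open>s > 0\<close> by simp
    show "0 \<le> s * infdist P S" using \<open>s > 0\<close> by (simp add: infdist_nonneg)
  qed
  also have "\<dots> \<le> a\<^sup>2 * (D\<^sup>2 - (infdist P S)\<^sup>2)"
    unfolding power_mult_distrib by (rule mult_left_mono) (use decrease in \<open>simp_all add: D_def\<close>)
  finally have "(a\<^sup>2 + s\<^sup>2) * (infdist P S)\<^sup>2 \<le> (a * D)\<^sup>2"
    by (simp add: algebra_simps power_mult_distrib)
  then have "(sqrt (a\<^sup>2 + s\<^sup>2) * infdist P S)\<^sup>2 \<le> (a * D)\<^sup>2"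
    using pos by (simp add: power_mult_distrib)
  then have "sqrt (a\<^sup>2 + s\<^sup>2) * infdist P S \<le> a * D"
    by (rule power2_le_imp_le) (use \<open>a \<ge> 0\<close> D in simp)
  then have exact: "infdist P S \<le> \<mu> * D"
    using pos by (simp add: mu pos_le_divide_eq mult.commute)
  have "(norm (x - P))\<^sup>2 \<le> D\<^sup>2"
    using decrease zero_le_power2[of "infdist P S"] unfolding D_def by linarith
  then have "norm (x - P) \<le> D" using D by (rule power2_le_imp_le)
  then have "norm (x' - x) \<le> \<delta> * norm (x' - x) + D"
    using norm_triangle_ineq[of "x' - P" "P - x"] near by (simp add: norm_minus_commute)
  then have "(1 - \<delta>) * norm (x' - x) \<le> D" by (simp add: algebra_simps)
  then have "\<delta> * norm (x' - x) \<le> \<delta> * (D / (1 - \<delta>))"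
    using \<open>0 \<le> \<delta>\<close> \<open>\<delta> < 1\<close> by (intro mult_left_mono) (simp_all add: pos_le_divide_eq mult.commute)
  then have le: "infdist x' S \<le> \<mu> * D + \<delta> * (D / (1 - \<delta>))"
    using infdist_triangle[of x' S P] near exact by (simp add: dist_norm)
  have nz: "1 - \<delta> \<noteq> 0" using \<open>\<delta> < 1\<close> by simp
  have "\<mu> * D + \<delta> * (D / (1 - \<delta>)) = (\<mu> * (1 - \<delta>) + \<delta>) / (1 - \<delta>) * D"
    using nz by (simp add: add_divide_distrib distrib_right)
  also have "\<dots> \<le> (\<mu> + 2 * \<delta>) / (1 - \<delta>) * D"
  proof (intro mult_right_mono[OF _ D] divide_right_mono)
    have "\<mu> * (1 - \<delta>) \<le> \<mu> * 1" by (rule mult_left_mono[OF _ mu0]) (use \<open>0 \<le> \<delta>\<close> in simp)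
    then show "\<mu> * (1 - \<delta>) + \<delta> \<le> \<mu> + 2 * \<delta>" using \<open>0 \<le> \<delta>\<close> by simp
  qed (use \<open>\<delta> < 1\<close> in simp)
  finally have "infdist x' S \<le> (\<mu> + 2 * \<delta>) / (1 - \<delta>) * D" using le by linarith
  then show ?thesis unfolding \<mu>_def D_def divide_inverse[of _ "1 - \<delta>"] .
qed

section \<open>Proximal points and duality of the composite problem\<close>

locale smooth_composite_problem =
  fixes A :: "'a::euclidean_space \<Rightarrow> 'b::euclidean_space"
    and c :: 'a and p :: "'a \<Rightarrow> ereal" and h :: "'b \<Rightarrow> real"
    and G :: "'b \<Rightarrow> 'b" and L :: real
  assumes linA: "linear A"
    and cpc: "closed_proper_convex p"
    and h_convex: "convex_on UNIV h"
    and h_grad: "\<And>u. GDERIV h u :> G u"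
    and L_pos: "L > 0"
    and h_lip: "L-lipschitz_on UNIV G"
    and solvable: "primal_solutions h p A c \<noteq> {}"
begin

abbreviation "S \<equiv> primal_solutions h p A c"
abbreviation "f \<equiv> primal_obj h p A c"
abbreviation "h_conj \<equiv> conjugate (\<lambda>u. ereal (h u))"
abbreviation "p_conj \<equiv> conjugate p"

definition smooth_part :: "'a \<Rightarrow> real" where
  "smooth_part u = h (A u) - c \<bullet> u"

text \<open>The value of \<open>y\<close> that stationarity of the Lagrangian in \<open>y\<close> attaches to a primal point.\<close>

definition dual_y :: "'a \<Rightarrow> 'b" where
  "dual_y u = G (A u)"

text \<open>The optimality condition of the proximal subproblem \<open>f u + (norm (u - x))\<^sup>2 / (2 * s)\<close>, solved for the
subgradient of \<open>p\<close>. In this form it exhibits the dual pair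
\<open>(dual_y P, c - adjoint A (dual_y P) + (1 / s) *\<^sub>R (x - P))\<close>, which minimises the augmented
Lagrangian exactly.\<close>

definition is_prox :: "real \<Rightarrow> 'a \<Rightarrow> 'a \<Rightarrow> bool" where
  "is_prox s x P \<longleftrightarrow> c - adjoint A (dual_y P) + (1 / s) *\<^sub>R (x - P) \<in> subdiff p P"

lemma f_eq: "f u = ereal (smooth_part u) + p u"
  by (simp add: primal_obj_def smooth_part_def)

lemma p_proper: "proper_fun p"
  using cpc by (simp add: closed_proper_convex_def)

lemma p_nmi: "p u \<noteq> -\<infinity>"
  using p_proper by (simp add: proper_fun_def)

lemma mem_S_iff: "w \<in> S \<longleftrightarrow> (\<forall>u. f w \<le> f u)"
  by (simp add: primal_solutions_def)

lemma S_finite: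
  assumes "w \<in> S" obtains m where "p w = ereal m"
proof -
  obtain u where "p u \<noteq> \<infinity>" using p_proper by (auto simp: proper_fun_def effdom_def)
  then have "f w \<noteq> \<infinity>"
    using assms p_nmi[of u] unfolding mem_S_iff f_eq by (cases "p u") (auto dest: spec[of _ u])
  then show ?thesis using that p_nmi[of w] by (cases "p w") (auto simp: f_eq)
qed

lemma subdiff_finite:
  assumes "v \<in> subdiff p P" obtains b where "p P = ereal b"
  using assms subdiff_empty[OF p_proper, of P] p_nmi[of P] by (cases "p P") auto

lemma adj: "u \<bullet> adjoint A v = A u \<bullet> v"
  by (rule adjoint_works[OF linA])

lemma adj': "adjoint A v \<bullet> u = v \<bullet> A u"
  using adj[of u v] by (simp add: inner_commute)

lemma smooth_part_lower:
  "smooth_part P + (adjoint A (dual_y P) - c) \<bullet> (u - P) \<le> smooth_part u"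
  using convex_gradient_inequality[OF h_convex h_grad, of "A P" "A u"]
  by (simp add: smooth_part_def dual_y_def inner_simps adj')

lemma smooth_part_upper:
  "smooth_part (P + t *\<^sub>R d) \<le> smooth_part P + t * ((adjoint A (dual_y P) - c) \<bullet> d) + t\<^sup>2 * (L * (norm (A d))\<^sup>2)"
  using convex_descent_inequality[OF h_convex h_grad h_lip, of "A (P + t *\<^sub>R d)" "A P"]
  by (simp add: smooth_part_def dual_y_def inner_simps adj' linear_add[OF linA] linear_scale[OF linA]
      power_mult_distrib algebra_simps)

lemma h_continuous: "continuous_on UNIV h"
  using h_grad by (auto simp: gderiv_def intro!: continuous_at_imp_continuous_on has_derivative_continuous)

lemma dual_y_continuous: "continuous_on UNIV dual_y"
  unfolding dual_y_def
  by (rule continuous_on_compose2[OF lipschitz_on_continuous_on[OF h_lip] linear_continuous_on])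
     (auto simp: linA linear_conv_bounded_linear[symmetric])

lemma smooth_part_continuous: "continuous_on UNIV smooth_part"
  unfolding smooth_part_def
  by (intro continuous_intros continuous_on_compose2[OF h_continuous linear_continuous_on])
     (auto simp: linA linear_conv_bounded_linear[symmetric])

lemma solution_subgradient:
  assumes "w \<in> S" shows "c - adjoint A (dual_y w) \<in> subdiff p w"
proof -
  obtain m where m: "p w = ereal m" using S_finite[OF assms] .
  have "- (adjoint A (dual_y w) - c) \<in> subdiff p w"
  proof (rule first_order_condition[where q = smooth_part and C = "\<lambda>d. L * (norm (A d))\<^sup>2"])
    show "ereal (smooth_part w) + p w \<le> ereal (smooth_part u) + p u" for u
      using assms by (simp add: mem_S_iff f_eq)
  qed (use m p_nmi smooth_part_upper closed_proper_convex_imp_segment_convex[OF cpc] in auto)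
  then show ?thesis by simp
qed

text \<open>The subproblem is treated as minimising a continuous function over the closed epigraph of \<open>p\<close>. The
proximal term makes it coercive because \<open>f\<close> is bounded below by its value at a solution, and the
minimum may be sought in a compact part of the epigraph.\<close>

lemma prox_exists:
  assumes s: "s > 0" shows "\<exists>P. is_prox s x P"
proof -
  define q where "q u = smooth_part u + (norm (u - x))\<^sup>2 / (2 * s)" for u
  define F where "F = (\<lambda>(u, r). q u + r)"
  obtain w where w: "w \<in> S" using solvable by blast
  obtain m where m: "p w = ereal m" using S_finite[OF w] .
  have low: "smooth_part w + m \<le> smooth_part u + r" if "p u \<le> ereal r" for u r
  proof -
    have "f w \<le> f u" using w by (simp add: mem_S_iff)
    then show ?thesis using m that p_nmi[of u] by (cases "p u") (auto simp: f_eq)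
  qed
  define K where "K = cball x (norm (w - x))"
  have "bounded (smooth_part ` K)"
    unfolding K_def
    by (intro compact_imp_bounded compact_continuous_image continuous_on_subset[OF smooth_part_continuous]) auto
  then obtain B where B: "\<And>u. u \<in> K \<Longrightarrow> \<bar>smooth_part u\<bar> \<le> B"
    by (auto simp: bounded_iff)
  have wK: "w \<in> K" by (simp add: K_def dist_norm norm_minus_commute)
  define D where "D = ereal_epigraph p \<inter> K \<times> {smooth_part w + m - B .. q w + m + B}"
  have "compact D"
    unfolding D_def
    by (rule closed_Int_compact) (use cpc in \<open>auto simp: closed_proper_convex_def K_def intro!: compact_Times\<close>)
  moreover have wD: "(w, m) \<in> D"
  proof -
    have "(norm (w - x))\<^sup>2 / (2 * s) \<ge> 0" using s by simp
    then have "smooth_part w + m - B \<le> m" "m \<le> q w + m + B"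
      using B[OF wK] unfolding q_def by linarith+
    then show ?thesis using m wK by (simp add: D_def ereal_epigraph_def)
  qed
  moreover have "continuous_on D F"
    unfolding F_def q_def case_prod_beta using s
    by (intro continuous_intros continuous_on_compose2[OF smooth_part_continuous]) auto
  ultimately obtain P b where Pb: "(P, b) \<in> D" and min: "\<And>u r. (u, r) \<in> D \<Longrightarrow> F (P, b) \<le> F (u, r)"
    using continuous_attains_inf[of D F] by (metis empty_iff surj_pair)
  have pP: "p P \<le> ereal b" using Pb by (simp add: D_def ereal_epigraph_def)
  then obtain a where a: "p P = ereal a" "a \<le> b" using p_nmi[of P] by (cases "p P") auto
  have opt: "ereal (q P) + p P \<le> ereal (q u) + p u" for u
  proof (cases "p u")
    case (real r)
    have "F (P, b) \<le> F (u, r)"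
    proof (cases "F (u, r) \<le> F (w, m)")
      case True
      have lr: "smooth_part w + m \<le> smooth_part u + r" using low real by simp
      with True have "(norm (u - x))\<^sup>2 / (2 * s) \<le> (norm (w - x))\<^sup>2 / (2 * s)"
        by (simp add: F_def q_def)
      then have "norm (u - x) \<le> norm (w - x)"
        using s by (simp add: divide_le_cancel)
      then have uK: "u \<in> K" by (simp add: K_def dist_norm norm_minus_commute)
      have "(norm (u - x))\<^sup>2 / (2 * s) \<ge> 0" using s by simp
      then have "(u, r) \<in> D"
        using B[OF uK] True lr real uK by (auto simp: D_def ereal_epigraph_def F_def q_def abs_le_iff)
      then show ?thesis by (rule min)
    next
      case False
      then show ?thesis using min[OF wD] by linarith
    qed
    then show ?thesis using a real by (simp add: F_def)
  qed (use p_nmi in auto)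
  have "- (adjoint A (dual_y P) - c + (1 / s) *\<^sub>R (P - x)) \<in> subdiff p P"
  proof (rule first_order_condition[where q = q and a = a and C = "\<lambda>d. L * (norm (A d))\<^sup>2 + (norm d)\<^sup>2 / (2 * s)"])
    fix d and t :: real
    have "(norm (P + t *\<^sub>R d - x))\<^sup>2 = (norm (P - x))\<^sup>2 + 2 * t * ((P - x) \<bullet> d) + t\<^sup>2 * (norm d)\<^sup>2"
      using norm_add_scaleR_squared[of "P - x" t d] by (simp add: algebra_simps)
    then have "(norm (P + t *\<^sub>R d - x))\<^sup>2 / (2 * s)
        = (norm (P - x))\<^sup>2 / (2 * s) + t * ((1 / s) * ((P - x) \<bullet> d)) + t\<^sup>2 * ((norm d)\<^sup>2 / (2 * s))"
      using s by (simp add: add_divide_distrib)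
    then show "q (P + t *\<^sub>R d) \<le> q P + t * ((adjoint A (dual_y P) - c + (1 / s) *\<^sub>R (P - x)) \<bullet> d)
        + t\<^sup>2 * (L * (norm (A d))\<^sup>2 + (norm d)\<^sup>2 / (2 * s))"
      using smooth_part_upper[of P t d] by (simp add: q_def inner_add_left distrib_left)
  qed (use closed_proper_convex_imp_segment_convex[OF cpc] p_nmi a opt in auto)
  then have "is_prox s x P" by (simp add: is_prox_def algebra_simps)
  then show ?thesis ..
qed

lemma prox_subgradient:
  assumes "is_prox s x P" shows "(1 / s) *\<^sub>R (x - P) \<in> subdiff f P"
proof -
  define v where "v = (1 / s) *\<^sub>R (x - P)"
  have sub: "c - adjoint A (dual_y P) + v \<in> subdiff p P" using assms by (simp add: is_prox_def v_def)
  obtain b where b: "p P = ereal b" using subdiff_finite[OF sub] .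
  have "f P + ereal (v \<bullet> (u - P)) \<le> f u" for u
  proof -
    have "ereal (b + (c - adjoint A (dual_y P) + v) \<bullet> (u - P)) \<le> p u"
      using sub b by (auto simp: subdiff_def)
    then show ?thesis
      using smooth_part_lower[of P u] p_nmi[of u] by (cases "p u") (auto simp: f_eq b inner_simps)
  qed
  then show ?thesis by (simp add: subdiff_def v_def)
qed

text \<open>Monotonicity of the subdifferential between \<open>P\<close>, with the subgradient \<open>(x - P) / s\<close>, and a minimiser,
with the subgradient \<open>0\<close>: the angle at \<open>P\<close> between \<open>x\<close> and \<open>w\<close> is not acute.\<close>

lemma prox_firm:
  assumes "is_prox s x P" "s > 0" "w \<in> S"
  shows "(norm (x - P))\<^sup>2 + (norm (P - w))\<^sup>2 \<le> (norm (x - w))\<^sup>2"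
proof -
  have "f P + ereal (((1 / s) *\<^sub>R (x - P)) \<bullet> (w - P)) \<le> f w"
    using prox_subgradient[OF assms(1)] by (simp add: subdiff_def)
  moreover obtain m where m: "p w = ereal m" using S_finite[OF assms(3)] .
  moreover have "f w \<le> f P" using assms(3) by (simp add: mem_S_iff)
  ultimately have "(1 / s) * ((x - P) \<bullet> (w - P)) \<le> 0"
    using p_nmi[of P] by (cases "p P") (auto simp: f_eq)
  then have "(x - P) \<bullet> (w - P) \<le> 0"
    using assms(2) by (simp add: divide_le_0_iff)
  moreover have "(norm (x - w))\<^sup>2 = (norm (x - P))\<^sup>2 + (norm (P - w))\<^sup>2 - 2 * ((x - P) \<bullet> (w - P))"
    by (simp add: power2_norm_eq_inner inner_simps inner_commute)
  ultimately show ?thesis by linarith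
qed

text \<open>The subgradient inequalities at the proximal points place explicit points in the epigraph of \<open>p\<close>;
their limit, which lies in the epigraph again, says that \<open>f l\<close> is at most the minimum.\<close>

lemma prox_limit_solution:
  assumes prox: "\<And>k. is_prox (s k) (x k) (P k)" and s: "\<And>k. s k \<ge> s0" "s0 > 0"
    and P: "P \<longlonglongrightarrow> l" and diff: "(\<lambda>k. x k - P k) \<longlonglongrightarrow> 0"
  shows "l \<in> S"
proof -
  obtain w where w: "w \<in> S" using solvable by blast
  obtain m where m: "p w = ereal m" using S_finite[OF w] .
  define v where "v k = (1 / s k) *\<^sub>R (x k - P k)" for k
  have "v \<longlonglongrightarrow> 0"
  proof (rule Lim_null_comparison)
    have "norm (v k) \<le> (1 / s0) * norm (x k - P k)" for k
      using s(1)[of k] s(2) by (auto simp: v_def divide_inverse intro!: mult_right_mono le_imp_inverse_le)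
    then show "\<forall>\<^sub>F k in sequentially. norm (v k) \<le> (1 / s0) * norm (x k - P k)" by simp
    show "(\<lambda>k. (1 / s0) * norm (x k - P k)) \<longlonglongrightarrow> 0"
      using tendsto_mult_left[OF tendsto_norm_zero[OF diff], of "1 / s0"] by simp
  qed
  then have lim: "(\<lambda>k. (P k, smooth_part w + m - v k \<bullet> (w - P k) - smooth_part (P k)))
      \<longlonglongrightarrow> (l, smooth_part w + m - 0 \<bullet> (w - l) - smooth_part l)"
    by (intro tendsto_intros P continuous_on_tendsto_compose[OF smooth_part_continuous P]) auto
  have "(P k, smooth_part w + m - v k \<bullet> (w - P k) - smooth_part (P k)) \<in> ereal_epigraph p" for k
  proof -
    have "f (P k) + ereal (v k \<bullet> (w - P k)) \<le> f w"
      using prox_subgradient[OF prox[of k]] by (simp add: subdiff_def v_def)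
    then show ?thesis
      using m p_nmi[of "P k"] by (cases "p (P k)") (auto simp: f_eq ereal_epigraph_def)
  qed
  then have "(l, smooth_part w + m - 0 \<bullet> (w - l) - smooth_part l) \<in> ereal_epigraph p"
    using closed_sequentially[OF _ _ lim] cpc by (auto simp: closed_proper_convex_def)
  then have "f l \<le> f w"
    using m p_nmi[of l] by (cases "p l") (auto simp: f_eq ereal_epigraph_def)
  then show ?thesis using w unfolding mem_S_iff by (meson order_trans)
qed

lemma h_conj_nmi: "h_conj v \<noteq> -\<infinity>"
  by (rule conjugate_neq_minus_infinity[OF proper_fun_real])

lemma p_conj_nmi: "p_conj v \<noteq> -\<infinity>"
  by (rule conjugate_neq_minus_infinity[OF p_proper])

lemma h_conj_dual_y: "h_conj (dual_y u) = ereal (dual_y u \<bullet> A u - h (A u))"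
  by (rule conjugate_at_subgradient)
     (use convex_gradient_inequality[OF h_convex h_grad] in \<open>auto simp: subdiff_def dual_y_def\<close>)

lemma h_conj_gap:
  "ereal (v \<bullet> A u - h (A u) + (norm (v - dual_y u))\<^sup>2 / (4 * L)) \<le> h_conj v"
  unfolding dual_y_def by (rule fenchel_young_gap[OF h_convex h_grad h_lip L_pos])

text \<open>The estimate that turns the stopping criteria into information about the iterates. The infimum is at
most the value \<open>val\<close> at the dual pair exhibited by the proximal point \<open>P\<close>, which equals minus the optimal
value of the proximal subproblem. Measured from there, the excess of the augmented Lagrangian at
\<open>(y, z)\<close> splits into two Fenchel--Young gaps at \<open>P\<close> and \<open>1 / (2 * s)\<close> times the squared distance
between the multiplier update \<open>x - s *\<^sub>R r\<close> and \<open>P\<close>. All three are nonnegative, so each is bounded by the gap;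
the gap for \<open>h\<close> moreover dominates a multiple of the squared distance of \<open>y\<close>
from \<open>dual_y P\<close>.\<close>

lemma augmented_lagrangian_gap:
  fixes x :: 'a
  assumes s: "s > 0" and prox: "is_prox s x P"
    and gap: "aug_lagrangian h p A c s y z x
        - (INF w. (\<lambda>(y, z). aug_lagrangian h p A c s y z x) w) \<le> ereal \<eta>"
  defines "r \<equiv> adjoint A y + z - c"
  shows "(norm (x - s *\<^sub>R r - P))\<^sup>2 / (2 * s) + (norm (y - dual_y P))\<^sup>2 / (4 * L) \<le> \<eta>"
    and "h_conj y \<noteq> \<infinity>" and "p_conj z \<noteq> \<infinity>"
proof -
  define y' r' where "y' = dual_y P" and "r' = (1 / s) *\<^sub>R (x - P)"
  define z' where "z' = c - adjoint A y' + r'"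
  have z': "z' \<in> subdiff p P" using prox by (simp add: is_prox_def z'_def y'_def r'_def)
  obtain b where b: "p P = ereal b" using subdiff_finite[OF z'] .
  define val where "val = c \<bullet> P - h (A P) - b - (norm (x - P))\<^sup>2 / (2 * s)"
  have "aug_lagrangian h p A c s y' z' x
      = ereal (y' \<bullet> A P - h (A P) + (z' \<bullet> P - b) - x \<bullet> r' + s / 2 * (norm r')\<^sup>2)"
    using conjugate_at_subgradient[OF z' b] h_conj_dual_y[of P]
    by (simp add: aug_lagrangian_def lagrangian_def y'_def z'_def)
  also have "y' \<bullet> A P - h (A P) + (z' \<bullet> P - b) - x \<bullet> r' + s / 2 * (norm r')\<^sup>2 = val"
  proof -
    have "z' \<bullet> P = c \<bullet> P - y' \<bullet> A P + r' \<bullet> P" by (simp add: z'_def inner_simps adj')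
    moreover have "x \<bullet> r' - r' \<bullet> P = s * (norm r')\<^sup>2"
      using s by (simp add: r'_def power2_norm_eq_inner inner_simps inner_commute algebra_simps)
    moreover have "(norm (x - P))\<^sup>2 / (2 * s) = s / 2 * (norm r')\<^sup>2"
      using s by (simp add: r'_def power_divide power2_eq_square)
    ultimately show ?thesis by (simp add: val_def algebra_simps)
  qed
  finally have val: "aug_lagrangian h p A c s y' z' x = ereal val" .
  have inf: "(INF w. (\<lambda>(y, z). aug_lagrangian h p A c s y z x) w) \<le> ereal val"
    using INF_lower[of "(y', z')" UNIV "\<lambda>(y, z). aug_lagrangian h p A c s y z x"] val by simp
  have nmi: "aug_lagrangian h p A c s y z x \<noteq> -\<infinity>"
    using h_conj_nmi[of y] p_conj_nmi[of z]
    by (cases "h_conj y"; cases "p_conj z") (auto simp: aug_lagrangian_def lagrangian_def)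
  have up: "aug_lagrangian h p A c s y z x \<le> ereal (\<eta> + val)"
    using gap inf nmi
    by (cases "aug_lagrangian h p A c s y z x";
        cases "INF w. (\<lambda>(y, z). aug_lagrangian h p A c s y z x) w") auto
  then show fin: "h_conj y \<noteq> \<infinity>" "p_conj z \<noteq> \<infinity>"
    using h_conj_nmi[of y] p_conj_nmi[of z]
    by (auto simp: aug_lagrangian_def lagrangian_def)
  obtain hy pz where hy: "h_conj y = ereal hy" and pz: "p_conj z = ereal pz"
    using fin h_conj_nmi[of y] p_conj_nmi[of z] by (cases "h_conj y"; cases "p_conj z") auto
  have "hy + pz - x \<bullet> r + s / 2 * (norm r)\<^sup>2 \<le> \<eta> + val"
    using up hy pz by (simp add: aug_lagrangian_def lagrangian_def r_def)
  moreover have "y \<bullet> A P - h (A P) + (norm (y - dual_y P))\<^sup>2 / (4 * L) \<le> hy"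
    using h_conj_gap[of y P] hy by simp
  moreover have "z \<bullet> P - b \<le> pz"
    using conjugate_ge[of z P p] b pz by simp
  moreover have "y \<bullet> A P + z \<bullet> P = r \<bullet> P + c \<bullet> P"
    by (simp add: r_def inner_simps adj')
  moreover have "(norm (x - s *\<^sub>R r - P))\<^sup>2 / (2 * s)
      = (norm (x - P))\<^sup>2 / (2 * s) + r \<bullet> P - x \<bullet> r + s / 2 * (norm r)\<^sup>2"
  proof -
    have "(norm (x - s *\<^sub>R r - P))\<^sup>2
        = (norm (x - P))\<^sup>2 + 2 * s * (r \<bullet> P - x \<bullet> r) + s\<^sup>2 * (norm r)\<^sup>2"
      using norm_add_scaleR_squared[of "x - P" "- s" r]
      by (simp add: inner_simps inner_commute[of r P] algebra_simps)
    then show ?thesis using s by (simp add: add_divide_distrib power2_eq_square)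
  qed
  ultimately show "(norm (x - s *\<^sub>R r - P))\<^sup>2 / (2 * s) + (norm (y - dual_y P))\<^sup>2 / (4 * L) \<le> \<eta>"
    by (simp add: val_def)
qed

text \<open>Adding the Fenchel--Young inequalities at a primal solution \<open>w\<close> gives weak duality, with equality at the
displayed pair. By the quantitative form of the inequality for \<open>h\<close>, any other feasible \<open>y\<close> is worse by at
least a fixed multiple of its squared distance, and \<open>z\<close> is determined by \<open>y\<close>.\<close>

lemma dual_solutions_eq:
  assumes w: "w \<in> S"
  shows "dual_solutions h p A c = {(dual_y w, c - adjoint A (dual_y w))}"
    and "p_conj (c - adjoint A (dual_y w)) \<noteq> \<infinity>"
proof -
  define zs where "zs = c - adjoint A (dual_y w)"
  obtain m where m: "p w = ereal m" using S_finite[OF w] .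
  have pz: "p_conj zs = ereal (zs \<bullet> w - m)"
    using conjugate_at_subgradient[OF solution_subgradient[OF w] m] by (simp add: zs_def)
  then show "p_conj (c - adjoint A (dual_y w)) \<noteq> \<infinity>" by (simp add: zs_def)
  define v where "v = c \<bullet> w - h (A w) - m"
  have opt: "dual_obj h p (dual_y w) zs = ereal v"
    using pz h_conj_dual_y[of w] by (simp add: dual_obj_def zs_def v_def inner_simps adj')
  have low: "ereal (v + (norm (y - dual_y w))\<^sup>2 / (4 * L)) \<le> dual_obj h p y z"
    if "adjoint A y + z = c" for y z
  proof -
    have "z = c - adjoint A y" using that by (simp add: algebra_simps)
    then have "y \<bullet> A w + z \<bullet> w = c \<bullet> w" by (simp add: inner_simps adj')
    moreover have "ereal (y \<bullet> A w - h (A w) + (norm (y - dual_y w))\<^sup>2 / (4 * L)) + ereal (z \<bullet> w - m)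
        \<le> dual_obj h p y z"
      unfolding dual_obj_def using h_conj_gap[of y w] conjugate_ge[of z w p] m
      by (intro add_mono) auto
    moreover have "y \<bullet> A w - h (A w) + (norm (y - dual_y w))\<^sup>2 / (4 * L) + (z \<bullet> w - m)
        = v + (norm (y - dual_y w))\<^sup>2 / (4 * L)"
      using \<open>y \<bullet> A w + z \<bullet> w = c \<bullet> w\<close> by (simp add: v_def)
    ultimately show ?thesis by (simp only: plus_ereal.simps)
  qed
  have feas: "adjoint A (dual_y w) + zs = c" by (simp add: zs_def)
  have "ereal v \<le> dual_obj h p y z" if "adjoint A y + z = c" for y z
    using low[OF that] by (rule order_trans[rotated]) (use L_pos in simp)
  then have "(dual_y w, zs) \<in> dual_solutions h p A c"
    by (simp add: dual_solutions_def feas opt)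
  moreover have "(y, z) \<in> {(dual_y w, zs)}" if yz: "(y, z) \<in> dual_solutions h p A c" for y z
  proof -
    have eq: "adjoint A y + z = c" and le: "dual_obj h p y z \<le> dual_obj h p (dual_y w) zs"
      using yz feas unfolding dual_solutions_def by blast+
    have "v + (norm (y - dual_y w))\<^sup>2 / (4 * L) \<le> v"
      using order_trans[OF low[OF eq] le] unfolding opt ereal_less_eq .
    then have "(norm (y - dual_y w))\<^sup>2 \<le> 0" using L_pos by (simp add: divide_le_0_iff)
    then have y: "y = dual_y w" by simp
    have "z = c - adjoint A y" unfolding eq[symmetric] by simp
    then show ?thesis by (simp add: y zs_def)
  qed
  then have "dual_solutions h p A c \<subseteq> {(dual_y w, zs)}" by (rule subrelI)
  ultimately show "dual_solutions h p A c = {(dual_y w, c - adjoint A (dual_y w))}"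
    unfolding zs_def[symmetric] by blast
qed

lemma proper_conjugates: "proper_fun h_conj" "proper_fun p_conj"
proof -
  obtain w where w: "w \<in> S" using solvable by blast
  have "h_conj (dual_y w) < \<infinity>" "p_conj (c - adjoint A (dual_y w)) < \<infinity>"
    using h_conj_dual_y[of w] dual_solutions_eq(2)[OF w] by auto
  then show "proper_fun h_conj" "proper_fun p_conj"
    using h_conj_nmi p_conj_nmi by (auto simp: proper_fun_def effdom_def)
qed

text \<open>A saddle point of the Lagrangian is dual feasible and minimises the Lagrangian in \<open>(y, z)\<close>; on the
feasible set the Lagrangian is the dual objective. As the dual solution is unique, the
\<open>(y, z)\<close>-distance to it is at most the distance to the zeros of \<open>T_l\<close>.\<close>

lemma T_l_zero_imp_dual_solution:
  assumes "0 \<in> T_l h p A c (y, z, x)"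
  shows "(y, z) \<in> dual_solutions h p A c"
proof -
  have feas: "adjoint A y + z = c"
    using assms unfolding T_l_explicit[OF linA proper_conjugates] by (auto simp: zero_prod_def)
  have min: "lagrangian h p A c y z x \<le> lagrangian h p A c y' z' x" for y' z'
    using assms by (auto simp: T_l_def lagrangian_subdiff_def subdiff_def zero_prod_def)
  have "dual_obj h p y z \<le> dual_obj h p y' z'" if "adjoint A y' + z' = c" for y' z'
    using min[of y' z'] feas that by (simp add: lagrangian_def dual_obj_def)
  then show ?thesis using feas by (simp add: dual_solutions_def)
qed

text \<open>The gradient in \<open>(y, z)\<close> of the penalty is that of \<open>s * (r \<bullet> (adjoint A y + z - c))\<close> with \<open>r\<close> held fixed, so the
multiplier update \<open>x - s *\<^sub>R r\<close> absorbs it: subgradients of the augmented Lagrangian at \<open>x\<close> are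
subgradients of the plain Lagrangian at the new multiplier.\<close>

lemma subgradient_shift_multiplier:
  assumes v: "(v1, v2) \<in> subdiff (\<lambda>(y, z). aug_lagrangian h p A c s y z x) (y, z)"
    and fin: "h_conj y \<noteq> \<infinity>" "p_conj z \<noteq> \<infinity>"
  defines "r \<equiv> adjoint A y + z - c"
  shows "(v1, v2, r) \<in> T_l h p A c (y, z, x - s *\<^sub>R r)"
proof -
  define x' where "x' = x - s *\<^sub>R r"
  define \<phi> where "\<phi> = (\<lambda>(y, z). h_conj y + p_conj z)"
  \<comment> \<open>The smooth part, tilted so that \<open>q + \<phi>\<close> is minimal at \<open>(y, z)\<close>.\<close>
  define q where "q = (\<lambda>(u, w). - (x \<bullet> (adjoint A u + w - c)) + s / 2 * (norm (adjoint A u + w - c))\<^sup>2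
      - (v1, v2) \<bullet> (u, w))"
  have aug: "aug_lagrangian h p A c s u w x = ereal (q (u, w) + (v1, v2) \<bullet> (u, w)) + \<phi> (u, w)" for u w
    using h_conj_nmi[of u] p_conj_nmi[of w]
    by (cases "h_conj u"; cases "p_conj w")
       (auto simp: aug_lagrangian_def lagrangian_def q_def \<phi>_def)
  have nmi: "\<phi> u \<noteq> -\<infinity>" for u
    using h_conj_nmi[of "fst u"] p_conj_nmi[of "snd u"]
    by (cases "h_conj (fst u)"; cases "p_conj (snd u)") (auto simp: \<phi>_def case_prod_beta)
  obtain a where a: "\<phi> (y, z) = ereal a"
    using fin h_conj_nmi[of y] p_conj_nmi[of z] by (cases "h_conj y"; cases "p_conj z") (auto simp: \<phi>_def)
  have "- (- A x' - v1, - x' - v2) \<in> subdiff \<phi> (y, z)"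
  proof (rule first_order_condition[where q = q and a = a
        and C = "\<lambda>d. s / 2 * (norm (adjoint A (fst d) + snd d))\<^sup>2"])
    show "segment_convex \<phi>"
      unfolding \<phi>_def
      by (intro segment_convex_sum conjugate_segment_convex proper_fun_real p_proper h_conj_nmi p_conj_nmi)
    show "ereal (q (y, z)) + \<phi> (y, z) \<le> ereal (q w) + \<phi> w" for w
    proof -
      obtain w1 w2 where w: "w = (w1, w2)" by (cases w)
      have "aug_lagrangian h p A c s y z x + ereal ((v1, v2) \<bullet> (w - (y, z))) \<le> aug_lagrangian h p A c s w1 w2 x"
        using v by (auto simp: subdiff_def w)
      then show ?thesis
        unfolding aug a using nmi[of w] by (cases "\<phi> w") (auto simp: w inner_simps)
    qed
    show "q ((y, z) + t *\<^sub>R d) \<le> q (y, z) + t * ((- A x' - v1, - x' - v2) \<bullet> d)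
        + t\<^sup>2 * (s / 2 * (norm (adjoint A (fst d) + snd d))\<^sup>2)" for d and t :: real
    proof -
      obtain d1 d2 where d: "d = (d1, d2)" by (cases d)
      define e where "e = adjoint A d1 + d2"
      have lin: "linear (adjoint A)" by (rule adjoint_linear[OF linA])
      have re: "adjoint A (y + t *\<^sub>R d1) + (z + t *\<^sub>R d2) - c = r + t *\<^sub>R e"
        by (simp add: r_def e_def linear_add[OF lin] linear_scale[OF lin] algebra_simps)
      have eq1: "(norm (r + t *\<^sub>R e))\<^sup>2 = (norm r)\<^sup>2 + 2 * t * (r \<bullet> e) + t\<^sup>2 * (norm e)\<^sup>2"
        by (rule norm_add_scaleR_squared)
      have eq2: "q ((y, z) + t *\<^sub>R d) = - (x \<bullet> (r + t *\<^sub>R e)) + s / 2 * (norm (r + t *\<^sub>R e))\<^sup>2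
          - (v1 \<bullet> (y + t *\<^sub>R d1) + v2 \<bullet> (z + t *\<^sub>R d2))"
        unfolding d q_def by (simp only: add_Pair scaleR_Pair prod.case re inner_Pair)
      have eq3: "q (y, z) = - (x \<bullet> r) + s / 2 * (norm r)\<^sup>2 - (v1 \<bullet> y + v2 \<bullet> z)"
        by (simp add: q_def r_def)
      have eq4: "(- A x' - v1, - x' - v2) \<bullet> d = s * (r \<bullet> e) - x \<bullet> e - v1 \<bullet> d1 - v2 \<bullet> d2"
      proof -
        have "A x' \<bullet> d1 + x' \<bullet> d2 = x' \<bullet> e" by (simp add: e_def inner_simps adj)
        moreover have "x' \<bullet> e = x \<bullet> e - s * (r \<bullet> e)" by (simp add: x'_def inner_simps)
        ultimately show ?thesis by (simp add: d inner_diff_left)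
      qed
      have eq5: "adjoint A (fst d) + snd d = e" by (simp add: d e_def)
      show ?thesis
        unfolding eq2 eq3 eq4 eq5 eq1 by (simp add: inner_add_right algebra_simps)
    qed
  qed (use nmi a in auto)
  then have sub: "(v1 + A x', v2 + x') \<in> subdiff \<phi> (y, z)" by (simp add: add.commute)
  have "ereal (a + (v1 + A x') \<bullet> (u - y) + (v2 + x') \<bullet> (w - z)) \<le> h_conj u + p_conj w" for u w
  proof -
    have "\<phi> (y, z) + ereal ((v1 + A x', v2 + x') \<bullet> ((u, w) - (y, z))) \<le> \<phi> (u, w)"
      using sub unfolding subdiff_def by blast
    then show ?thesis unfolding a by (simp add: \<phi>_def add.assoc)
  qed
  moreover have "h_conj y + p_conj z = ereal a" using a by (simp add: \<phi>_def)
  ultimately have "(v1, v2) \<in> subdiff (\<lambda>(y, z). lagrangian h p A c y z x') (y, z)"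
  proof -
    assume *: "\<And>u w. ereal (a + (v1 + A x') \<bullet> (u - y) + (v2 + x') \<bullet> (w - z)) \<le> h_conj u + p_conj w"
      "h_conj y + p_conj z = ereal a"
    have "lagrangian h p A c y z x' + ereal (v1 \<bullet> (u - y) + v2 \<bullet> (w - z)) \<le> lagrangian h p A c u w x'" for u w
      using *(1)[of u w] *(2) h_conj_nmi[of u] p_conj_nmi[of w]
      by (cases "h_conj u"; cases "p_conj w") (auto simp: lagrangian_def inner_simps adj)
    then show ?thesis by (auto simp: subdiff_def)
  qed
  moreover have "- r \<in> superdiff (\<lambda>x. lagrangian h p A c y z x) x'"
    using \<open>h_conj y + p_conj z = ereal a\<close>
    by (simp add: superdiff_def lagrangian_def r_def[symmetric] inner_simps inner_commute)
  ultimately show ?thesis by (simp add: T_l_def lagrangian_subdiff_def x'_def)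
qed

end

section \<open>Limits of the rates\<close>

lemma increasing_limit_cases:
  fixes \<sigma> :: "nat \<Rightarrow> real"
  assumes pos: "\<And>k. \<sigma> k > 0" and inc: "incseq \<sigma>" and lim: "(\<lambda>k. ereal (\<sigma> k)) \<longlonglongrightarrow> \<sigma>_inf"
  obtains (finite) s where "\<sigma>_inf = ereal s" "s > 0" "\<sigma> \<longlonglongrightarrow> s"
    | (infinite) "\<sigma>_inf = \<infinity>" "(\<lambda>k. 1 / \<sigma> k) \<longlonglongrightarrow> 0"
proof -
  have "ereal (\<sigma> 0) \<le> \<sigma>_inf"
    using incseqD[OF inc] by (intro LIMSEQ_le_const[OF lim]) auto
  then have gt: "\<sigma>_inf > 0" using pos[of 0] by (auto elim: less_le_trans[rotated])
  show thesis
  proof (cases \<sigma>_inf)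
    case (real s)
    then show ?thesis using gt lim finite by (simp add: zero_ereal_def)
  next
    case PInf
    then have "filterlim \<sigma> at_top sequentially"
      using lim by (simp add: tendsto_PInfty_eq_at_top)
    then have "(\<lambda>k. 1 / \<sigma> k) \<longlonglongrightarrow> 0"
      by (rule real_tendsto_divide_at_top[OF tendsto_const])
    then show ?thesis using infinite PInf by simp
  qed (use gt in auto)
qed

lemma rate_limit:
  fixes \<sigma> \<delta> :: "nat \<Rightarrow> real"
  assumes pos: "\<And>k. \<sigma> k > 0" and inc: "incseq \<sigma>" and lim: "(\<lambda>k. ereal (\<sigma> k)) \<longlonglongrightarrow> \<sigma>_inf"
    and \<delta>: "\<delta> \<longlonglongrightarrow> 0" and a: "a \<ge> 0"
  shows "rate a \<sigma> \<delta> \<longlonglongrightarrow> rate_inf a \<sigma>_inf" and "rate_inf a \<sigma>_inf < 1"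
proof -
  have "((\<lambda>k. a * (a\<^sup>2 + (\<sigma> k)\<^sup>2) powr (- 1/2)) \<longlonglongrightarrow> rate_inf a \<sigma>_inf) \<and> rate_inf a \<sigma>_inf < 1"
    using pos inc lim
  proof (cases rule: increasing_limit_cases)
    case (finite s)
    have sq: "a\<^sup>2 + s\<^sup>2 > 0" using finite by (simp add: add_nonneg_pos)
    have ri: "rate_inf a \<sigma>_inf = a * (a\<^sup>2 + s\<^sup>2) powr (- 1/2)"
      unfolding rate_inf_def finite(1) by (simp only: PInfty_neq_ereal if_False real_of_ereal.simps ereal.distinct)
    have "a < sqrt (a\<^sup>2 + s\<^sup>2)"
      by (rule real_less_rsqrt) (use finite in simp)
    then have "a * (a\<^sup>2 + s\<^sup>2) powr (- 1/2) < 1"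
      unfolding powr_minus_half_eq[OF sq] using sq by simp
    moreover have "(\<lambda>k. a * (a\<^sup>2 + (\<sigma> k)\<^sup>2) powr (- 1/2)) \<longlonglongrightarrow> a * (a\<^sup>2 + s\<^sup>2) powr (- 1/2)"
      by (intro tendsto_intros finite) (use sq in linarith)
    ultimately show ?thesis unfolding ri by blast
  next
    case infinite
    have ri: "rate_inf a \<sigma>_inf = 0" using infinite by (simp add: rate_inf_def)
    have "(\<lambda>k. a * (a\<^sup>2 + (\<sigma> k)\<^sup>2) powr (- 1/2)) \<longlonglongrightarrow> 0"
    proof (rule tendsto_sandwich[OF _ _ tendsto_const])
      show "(\<lambda>k. a * (1 / \<sigma> k)) \<longlonglongrightarrow> 0"
        using tendsto_mult_left[OF infinite(2), of a] by simp
      have b: "0 \<le> a * (a\<^sup>2 + (\<sigma> k)\<^sup>2) powr (- 1/2)" for k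
        by (rule mult_nonneg_nonneg[OF a powr_ge_zero])
      then show "\<forall>\<^sub>F k in sequentially. 0 \<le> a * (a\<^sup>2 + (\<sigma> k)\<^sup>2) powr (- 1/2)"
        by (rule always_eventually[OF allI])
      have "a * (a\<^sup>2 + (\<sigma> k)\<^sup>2) powr (- 1/2) \<le> a * (1 / \<sigma> k)" for k
      proof -
        have sq: "a\<^sup>2 + (\<sigma> k)\<^sup>2 > 0" using pos[of k] by (simp add: add_nonneg_pos)
        have "\<sigma> k \<le> sqrt (a\<^sup>2 + (\<sigma> k)\<^sup>2)" by (rule real_le_rsqrt) simp
        then have "1 / sqrt (a\<^sup>2 + (\<sigma> k)\<^sup>2) \<le> 1 / \<sigma> k"
          by (rule divide_left_mono[OF _ zero_le_one mult_pos_pos[OF _ pos]]) (use sq in simp)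
        then show ?thesis unfolding powr_minus_half_eq[OF sq] by (rule mult_left_mono[OF _ a])
      qed
      then show "\<forall>\<^sub>F k in sequentially. a * (a\<^sup>2 + (\<sigma> k)\<^sup>2) powr (- 1/2) \<le> a * (1 / \<sigma> k)"
        by (rule always_eventually[OF allI])
    qed
    then show ?thesis unfolding ri by simp
  qed
  then have main: "(\<lambda>k. a * (a\<^sup>2 + (\<sigma> k)\<^sup>2) powr (- 1/2)) \<longlonglongrightarrow> rate_inf a \<sigma>_inf"
    and lt: "rate_inf a \<sigma>_inf < 1" by blast+
  have "(\<lambda>k. (a * (a\<^sup>2 + (\<sigma> k)\<^sup>2) powr (- 1/2) + 2 * \<delta> k) * inverse (1 - \<delta> k))
      \<longlonglongrightarrow> (rate_inf a \<sigma>_inf + 2 * 0) * inverse (1 - 0)"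
    by (intro tendsto_mult tendsto_add tendsto_inverse tendsto_diff tendsto_const main \<delta>) simp
  then have "(\<lambda>k. (a * (a\<^sup>2 + (\<sigma> k)\<^sup>2) powr (- 1/2) + 2 * \<delta> k) * inverse (1 - \<delta> k))
      \<longlonglongrightarrow> rate_inf a \<sigma>_inf"
    by (simp only: mult_zero_right add_0_right diff_zero inverse_1 mult_1_right)
  then show "rate a \<sigma> \<delta> \<longlonglongrightarrow> rate_inf a \<sigma>_inf" unfolding rate_def[abs_def] .
  show "rate_inf a \<sigma>_inf < 1" by (rule lt)
qed

lemma rate'_limit:
  fixes \<sigma> \<delta> :: "nat \<Rightarrow> real"
  assumes pos: "\<And>k. \<sigma> k > 0" and inc: "incseq \<sigma>" and lim: "(\<lambda>k. ereal (\<sigma> k)) \<longlonglongrightarrow> \<sigma>_inf"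
    and \<delta>: "\<delta> \<longlonglongrightarrow> 0"
  shows "rate' a \<sigma> \<delta> \<longlonglongrightarrow> rate'_inf a \<sigma>_inf"
  using pos inc lim
proof (cases rule: increasing_limit_cases)
  case (finite s)
  have "(\<lambda>k. a * (1 + \<delta> k) / \<sigma> k) \<longlonglongrightarrow> a * (1 + 0) / s"
    by (intro tendsto_intros \<delta> finite) (use finite in simp)
  then show ?thesis using finite by (simp add: rate'_def[abs_def] rate'_inf_def)
next
  case infinite
  have "(\<lambda>k. a * (1 + \<delta> k) * (1 / \<sigma> k)) \<longlonglongrightarrow> a * (1 + 0) * 0"
    by (intro tendsto_intros \<delta> infinite)
  then show ?thesis using infinite by (simp add: rate'_def[abs_def] rate'_inf_def)
qed

section \<open>The augmented Lagrangian iteration\<close>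

locale inexact_augmented_lagrangian = smooth_composite_problem A c p h G L
  for A :: "'a::euclidean_space \<Rightarrow> 'b::euclidean_space"
    and c :: 'a and p :: "'a \<Rightarrow> ereal" and h :: "'b \<Rightarrow> real"
    and G :: "'b \<Rightarrow> 'b" and L :: real +
  fixes \<sigma> \<epsilon> \<delta> :: "nat \<Rightarrow> real" and \<sigma>_inf :: ereal
    and y :: "nat \<Rightarrow> 'b" and z x :: "nat \<Rightarrow> 'a"
  assumes run: "ssnal_sequence h p A c \<sigma> \<sigma>_inf y z x"
    and stopA: "stop_A h p A c \<sigma> y z x \<epsilon>"
    and stopB1: "stop_B1 h p A c \<sigma> y z x \<delta>"
begin

lemma \<sigma>_pos: "\<sigma> k > 0" and \<sigma>_inc: "incseq \<sigma>" and \<sigma>_lim: "(\<lambda>k. ereal (\<sigma> k)) \<longlonglongrightarrow> \<sigma>_inf"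
  and x_Suc: "x (Suc k) = x k - \<sigma> k *\<^sub>R (adjoint A (y (Suc k)) + z (Suc k) - c)"
  using run by (auto simp: ssnal_sequence_def)

lemma residual_eq: "adjoint A (y (Suc k)) + z (Suc k) - c = (1 / \<sigma> k) *\<^sub>R (x k - x (Suc k))"
proof -
  have "w = (1 / \<sigma> k) *\<^sub>R (x k - (x k - \<sigma> k *\<^sub>R w))" for w :: 'a
    using \<sigma>_pos[of k] by simp
  then show ?thesis unfolding x_Suc .
qed

lemma \<sigma>_ge: "\<sigma> 0 \<le> \<sigma> k"
  using incseqD[OF \<sigma>_inc, of 0 k] by simp

lemma \<epsilon>_nonneg: "\<epsilon> k \<ge> 0" and \<epsilon>_summable: "summable \<epsilon>"
  using stopA by (auto simp: stop_A_def)

lemma \<delta>_nonneg: "\<delta> k \<ge> 0" and \<delta>_null: "\<delta> \<longlonglongrightarrow> 0"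
  using stopB1 by (auto simp: stop_B1_def intro: summable_LIMSEQ_zero)

definition prox_point :: "nat \<Rightarrow> 'a" where
  "prox_point k = (SOME P. is_prox (\<sigma> k) (x k) P)"

lemma prox_point: "is_prox (\<sigma> k) (x k) (prox_point k)"
  unfolding prox_point_def using prox_exists[OF \<sigma>_pos] by (rule someI_ex)

text \<open>The tolerance \<open>e\<close> is arbitrary so that both stopping criteria on the values of \<open>Psi\<close> are covered.\<close>

lemma iterate_gap:
  assumes "Psi h p A c \<sigma> x k (y (Suc k), z (Suc k)) - (INF w. Psi h p A c \<sigma> x k w) \<le> ereal (e\<^sup>2 / (2 * \<sigma> k))"
    and "e \<ge> 0"
  shows "norm (x (Suc k) - prox_point k) \<le> e"
    and "(norm (y (Suc k) - dual_y (prox_point k)))\<^sup>2 \<le> 4 * L * (e\<^sup>2 / (2 * \<sigma> k))"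
    and "h_conj (y (Suc k)) \<noteq> \<infinity>" and "p_conj (z (Suc k)) \<noteq> \<infinity>"
proof -
  have "aug_lagrangian h p A c (\<sigma> k) (y (Suc k)) (z (Suc k)) (x k)
      - (INF w. (\<lambda>(y, z). aug_lagrangian h p A c (\<sigma> k) y z (x k)) w) \<le> ereal (e\<^sup>2 / (2 * \<sigma> k))"
    using assms by (simp add: Psi_def)
  note gap = augmented_lagrangian_gap[OF \<sigma>_pos prox_point this, folded x_Suc]
  show "h_conj (y (Suc k)) \<noteq> \<infinity>" "p_conj (z (Suc k)) \<noteq> \<infinity>" by (rule gap)+
  have nn: "(norm (x (Suc k) - prox_point k))\<^sup>2 / (2 * \<sigma> k) \<ge> 0"
    "(norm (y (Suc k) - dual_y (prox_point k)))\<^sup>2 / (4 * L) \<ge> 0"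
    using \<sigma>_pos[of k] L_pos by simp_all
  have "(norm (x (Suc k) - prox_point k))\<^sup>2 / (2 * \<sigma> k) \<le> e\<^sup>2 / (2 * \<sigma> k)"
    using gap(1) nn by linarith
  then have "(norm (x (Suc k) - prox_point k))\<^sup>2 \<le> e\<^sup>2"
    using \<sigma>_pos[of k] by (simp add: divide_le_cancel)
  then show "norm (x (Suc k) - prox_point k) \<le> e"
    using assms(2) by (rule power2_le_imp_le)
  have "(norm (y (Suc k) - dual_y (prox_point k)))\<^sup>2 / (4 * L) \<le> e\<^sup>2 / (2 * \<sigma> k)"
    using gap(1) nn by linarith
  then show "(norm (y (Suc k) - dual_y (prox_point k)))\<^sup>2 \<le> 4 * L * (e\<^sup>2 / (2 * \<sigma> k))"
    using L_pos by (simp add: pos_divide_le_eq mult.commute)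
qed

lemma stop_A_gap:
  "Psi h p A c \<sigma> x k (y (Suc k), z (Suc k)) - (INF w. Psi h p A c \<sigma> x k w) \<le> ereal ((\<epsilon> k)\<^sup>2 / (2 * \<sigma> k))"
  using stopA unfolding stop_A_def by blast

text \<open>The criterion \<open>stop_B1\<close> has the form of \<open>stop_A\<close> with the tolerance \<open>\<delta> k * norm (x (Suc k) - x k)\<close>.\<close>

lemma stop_B1_near: "norm (x (Suc k) - prox_point k) \<le> \<delta> k * norm (x (Suc k) - x k)"
proof (rule iterate_gap)
  have "Psi h p A c \<sigma> x k (y (Suc k), z (Suc k)) - (INF w. Psi h p A c \<sigma> x k w)
      \<le> ereal ((\<delta> k)\<^sup>2 / (2 * \<sigma> k) * (norm (x (Suc k) - x k))\<^sup>2)"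
    using stopB1 unfolding stop_B1_def by blast
  then show "Psi h p A c \<sigma> x k (y (Suc k), z (Suc k)) - (INF w. Psi h p A c \<sigma> x k w)
      \<le> ereal ((\<delta> k * norm (x (Suc k) - x k))\<^sup>2 / (2 * \<sigma> k))"
    by (simp add: power_mult_distrib)
qed (simp add: \<delta>_nonneg)

lemma primal_convergence: "\<exists>l\<in>S. x \<longlonglongrightarrow> l \<and> prox_point \<longlonglongrightarrow> l"
proof (rule quasi_fejer_convergence[OF solvable \<epsilon>_summable \<epsilon>_nonneg])
  show "norm (x (Suc k) - prox_point k) \<le> \<epsilon> k" for k
    by (rule iterate_gap(1)[OF stop_A_gap \<epsilon>_nonneg])
  show "(norm (x k - prox_point k))\<^sup>2 + (norm (prox_point k - w))\<^sup>2 \<le> (norm (x k - w))\<^sup>2"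
    if "w \<in> S" for k w
    by (rule prox_firm[OF prox_point \<sigma>_pos that])
  show "l \<in> S" if "(\<lambda>k. prox_point (r k)) \<longlonglongrightarrow> l" "(\<lambda>k. x (r k) - prox_point (r k)) \<longlonglongrightarrow> 0" for r l
    by (rule prox_limit_solution[OF prox_point \<sigma>_ge \<sigma>_pos that])
qed

lemma scaled_null:
  fixes d :: "nat \<Rightarrow> 'd::real_normed_vector"
  assumes "d \<longlonglongrightarrow> 0" shows "(\<lambda>k. (1 / \<sigma> k) *\<^sub>R d k) \<longlonglongrightarrow> 0"
proof (rule Lim_null_comparison)
  have "1 / \<sigma> k \<le> 1 / \<sigma> 0" for k
    using \<sigma>_ge[of k] \<sigma>_pos[of 0] by (intro divide_left_mono) (auto intro: mult_pos_pos \<sigma>_pos)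
  then have "norm ((1 / \<sigma> k) *\<^sub>R d k) \<le> (1 / \<sigma> 0) * norm (d k)" for k
    using mult_right_mono[of "1 / \<sigma> k" "1 / \<sigma> 0" "norm (d k)"] \<sigma>_pos[of k] by simp
  then show "\<forall>\<^sub>F k in sequentially. norm ((1 / \<sigma> k) *\<^sub>R d k) \<le> (1 / \<sigma> 0) * norm (d k)" by simp
  show "(\<lambda>k. (1 / \<sigma> 0) * norm (d k)) \<longlonglongrightarrow> 0"
    using tendsto_mult_left[OF tendsto_norm_zero[OF assms], of "1 / \<sigma> 0"] by simp
qed

text \<open>The gap at the \<open>k\<close>-th step pins \<open>y (Suc k)\<close> to \<open>dual_y (prox_point k)\<close>, and \<open>dual_y\<close> is continuous. The
update rule gives \<open>z (Suc k)\<close>, since the constraint residual is \<open>(x k - x (Suc k)) / \<sigma> k\<close>.\<close>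

lemma dual_convergence:
  assumes x: "x \<longlonglongrightarrow> l" and P: "prox_point \<longlonglongrightarrow> l"
  shows "(\<lambda>k. (y k, z k)) \<longlonglongrightarrow> (dual_y l, c - adjoint A (dual_y l))"
proof -
  have "(\<lambda>k. (1 / \<sigma> k) *\<^sub>R (2 * L * (\<epsilon> k)\<^sup>2)) \<longlonglongrightarrow> 0"
  proof (rule scaled_null)
    have "(\<lambda>k. 2 * L * (\<epsilon> k)\<^sup>2) \<longlonglongrightarrow> 2 * L * 0\<^sup>2"
      by (intro tendsto_intros summable_LIMSEQ_zero[OF \<epsilon>_summable])
    then show "(\<lambda>k. 2 * L * (\<epsilon> k)\<^sup>2) \<longlonglongrightarrow> 0" by simp
  qed
  then have "(\<lambda>k. (norm (y (Suc k) - dual_y (prox_point k)))\<^sup>2) \<longlonglongrightarrow> 0"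
  proof (rule tendsto_sandwich[OF always_eventually always_eventually tendsto_const, rotated 2])
    have eq: "4 * L * ((\<epsilon> k)\<^sup>2 / (2 * \<sigma> k)) = (1 / \<sigma> k) *\<^sub>R (2 * L * (\<epsilon> k)\<^sup>2)" for k
      by simp
    show "\<forall>k. (norm (y (Suc k) - dual_y (prox_point k)))\<^sup>2 \<le> (1 / \<sigma> k) *\<^sub>R (2 * L * (\<epsilon> k)\<^sup>2)"
      unfolding eq[symmetric] using iterate_gap(2)[OF stop_A_gap \<epsilon>_nonneg] by blast
  qed simp
  then have "(\<lambda>k. y (Suc k) - dual_y (prox_point k)) \<longlonglongrightarrow> 0"
    by (simp add: tendsto_norm_zero_iff)
  moreover have "(\<lambda>k. dual_y (prox_point k)) \<longlonglongrightarrow> dual_y l"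
    by (rule continuous_on_tendsto_compose[OF dual_y_continuous P]) auto
  ultimately have y: "(\<lambda>k. y (Suc k)) \<longlonglongrightarrow> dual_y l"
    using tendsto_add by fastforce
  have "(\<lambda>k. x k - x (Suc k)) \<longlonglongrightarrow> 0"
    using tendsto_diff[OF x LIMSEQ_Suc[OF x]] by simp
  then have r: "(\<lambda>k. (1 / \<sigma> k) *\<^sub>R (x k - x (Suc k))) \<longlonglongrightarrow> 0" by (rule scaled_null)
  have "bounded_linear (adjoint A)"
    using adjoint_linear[OF linA] by (simp add: linear_conv_bounded_linear)
  then have Ay: "(\<lambda>k. adjoint A (y (Suc k))) \<longlonglongrightarrow> adjoint A (dual_y l)"
    by (rule bounded_linear.tendsto[OF _ y])
  have z_eq: "z (Suc k) = c + (1 / \<sigma> k) *\<^sub>R (x k - x (Suc k)) - adjoint A (y (Suc k))" for k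
    unfolding residual_eq[symmetric] by simp
  have "(\<lambda>k. z (Suc k)) \<longlonglongrightarrow> c + 0 - adjoint A (dual_y l)"
    unfolding z_eq by (intro tendsto_diff tendsto_add tendsto_const r Ay)
  then have z: "(\<lambda>k. z (Suc k)) \<longlonglongrightarrow> c - adjoint A (dual_y l)" unfolding add_0_right .
  show ?thesis by (rule LIMSEQ_imp_Suc[OF tendsto_Pair[OF y z]])
qed

text \<open>The proximal step provides the subgradient \<open>(x k - prox_point k) / \<sigma> k\<close> of \<open>f\<close>, which is eventually
small enough for the error bound to apply.\<close>

lemma primal_rate:
  assumes x: "x \<longlonglongrightarrow> l" and P: "prox_point \<longlonglongrightarrow> l"
    and eb: "error_bound (subdiff f) 0 a"
  shows "\<forall>\<^sub>F k in sequentially. set_dist (x (Suc k)) S \<le> ereal (rate a \<sigma> \<delta> k) * set_dist (x k) S"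
proof -
  have inv: "mv_inv (subdiff f) 0 = S"
    by (auto simp: mv_inv_def subdiff_def mem_S_iff)
  obtain e where a: "a \<ge> 0" and e: "e > 0"
    and bound: "\<And>u. set_dist 0 (subdiff f u) \<le> ereal e \<Longrightarrow> set_dist u S \<le> ereal a * set_dist 0 (subdiff f u)"
    using eb unfolding error_bound_def inv by blast
  have "(\<lambda>k. x k - prox_point k) \<longlonglongrightarrow> 0" using tendsto_diff[OF x P] by simp
  from tendsto_norm_zero[OF scaled_null[OF this]]
  have "\<forall>\<^sub>F k in sequentially. norm ((1 / \<sigma> k) *\<^sub>R (x k - prox_point k)) < e"
    using e by (rule order_tendstoD(2))
  moreover have "\<forall>\<^sub>F k in sequentially. \<delta> k < 1"
    by (rule order_tendstoD(2)[OF \<delta>_null]) simp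
  ultimately show ?thesis
  proof eventually_elim
    case (elim k)
    let ?P = "prox_point k"
    let ?v = "(1 / \<sigma> k) *\<^sub>R (x k - ?P)"
    have sd: "set_dist 0 (subdiff f ?P) \<le> ereal (norm ?v)"
      using INF_lower[OF prox_subgradient[OF prox_point[of k]], of "\<lambda>v. ereal (norm (0 - v))"]
      unfolding set_dist_def by (simp only: diff_0 norm_minus_cancel)
    then have "set_dist ?P S \<le> ereal a * set_dist 0 (subdiff f ?P)"
      using elim(1) by (intro bound) (auto elim: order_trans)
    also have "\<dots> \<le> ereal a * ereal (norm ?v)"
      using sd a by (intro ereal_mult_left_mono) auto
    finally have err: "infdist ?P S \<le> a * (norm (x k - ?P) / \<sigma> k)"
      using \<sigma>_pos[of k] by (simp add: set_dist_eq_infdist[OF solvable])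
    have "infdist (x (Suc k)) S
        \<le> (a * (a\<^sup>2 + (\<sigma> k)\<^sup>2) powr (- 1/2) + 2 * \<delta> k) * inverse (1 - \<delta> k) * infdist (x k) S"
      by (rule inexact_proximal_contraction[OF \<sigma>_pos a \<delta>_nonneg elim(2) _ err stop_B1_near])
         (rule infdist_proximal_decrease[OF solvable prox_firm[OF prox_point \<sigma>_pos]])
    then show ?case
      unfolding set_dist_eq_infdist[OF solvable] rate_def times_ereal.simps ereal_less_eq .
  qed
qed

text \<open>A nearly minimal subgradient in \<open>stop_B2\<close>, shifted to the multiplier \<open>x (Suc k)\<close> and completed by the
constraint residual, is an element of \<open>T_l\<close> at the new iterate, and its norm is at most
\<open>(1 + \<delta>' k) / \<sigma> k * norm (x (Suc k) - x k)\<close> up to an arbitrarily small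
slack. It eventually enters every neighbourhood of \<open>0\<close>, so subregularity bounds the distance to the zeros of \<open>T_l\<close>, hence to the dual solution.\<close>

lemma dual_rate:
  assumes l: "l \<in> S" and x: "x \<longlonglongrightarrow> l" and P: "prox_point \<longlonglongrightarrow> l"
    and sub: "metrically_subregular (T_l h p A c) (dual_y l, c - adjoint A (dual_y l), l) 0 a"
    and stopB2: "stop_B2 h p A c \<sigma> y z x \<delta>'"
  shows "\<forall>\<^sub>F k in sequentially. norm ((y (Suc k), z (Suc k)) - (dual_y l, c - adjoint A (dual_y l)))
      \<le> rate' a \<sigma> \<delta>' k * norm (x (Suc k) - x k)"
proof -
  define ys zs where "ys = dual_y l" and "zs = c - adjoint A (dual_y l)"
  define T where "T = T_l h p A c"
  define \<beta> where "\<beta> k = (1 + \<delta>' k) / \<sigma> k * norm (x (Suc k) - x k)" for k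
  have \<delta>': "\<And>k. \<delta>' k \<ge> 0" "\<delta>' \<longlonglongrightarrow> 0" using stopB2 by (auto simp: stop_B2_def)
  obtain U V where a: "a \<ge> 0" and U: "open U" "(ys, zs, l) \<in> U" and V: "open V" "0 \<in> V"
    and reg: "\<And>u. u \<in> U \<Longrightarrow> T u \<inter> V \<noteq> {} \<Longrightarrow> set_dist u (mv_inv T 0) \<le> ereal a * set_dist 0 (T u \<inter> V)"
    using sub unfolding metrically_subregular_def T_def ys_def zs_def by blast
  obtain \<rho> where \<rho>: "\<rho> > 0" "ball 0 \<rho> \<subseteq> V" using V by (auto simp: open_contains_ball)
  have yz: "(\<lambda>k. (y k, z k)) \<longlonglongrightarrow> (ys, zs)"
    using dual_convergence[OF x P] by (simp add: ys_def zs_def)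
  have "(\<lambda>k. (y (Suc k), z (Suc k), x (Suc k))) \<longlonglongrightarrow> (ys, zs, l)"
    using tendsto_fst[OF LIMSEQ_Suc[OF yz]] tendsto_snd[OF LIMSEQ_Suc[OF yz]] LIMSEQ_Suc[OF x]
    by (auto intro!: tendsto_Pair)
  then have inU: "\<forall>\<^sub>F k in sequentially. (y (Suc k), z (Suc k), x (Suc k)) \<in> U"
    using U by (rule topological_tendstoD)
  have "\<beta> \<longlonglongrightarrow> 0"
  proof -
    have "(\<lambda>k. (1 + \<delta>' k) * norm (x (Suc k) - x k)) \<longlonglongrightarrow> (1 + 0) * norm (l - l)"
      by (intro tendsto_intros \<delta>' x LIMSEQ_Suc[OF x])
    then have "(\<lambda>k. (1 / \<sigma> k) *\<^sub>R ((1 + \<delta>' k) * norm (x (Suc k) - x k))) \<longlonglongrightarrow> 0"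
      by (intro scaled_null) simp
    then show ?thesis by (simp add: \<beta>_def[abs_def])
  qed
  then have "\<forall>\<^sub>F k in sequentially. \<beta> k < \<rho>" using \<rho>(1) by (rule order_tendstoD(2))
  with inU show ?thesis
  proof eventually_elim
    case (elim k)
    let ?u = "(y (Suc k), z (Suc k), x (Suc k))"
    let ?n = "norm ((y (Suc k), z (Suc k)) - (ys, zs))"
    have low: "ereal ?n \<le> set_dist ?u (mv_inv T 0)"
      unfolding set_dist_def
    proof (rule INF_greatest)
      fix u' assume "u' \<in> mv_inv T 0"
      then obtain y' z' x' where u': "u' = (y', z', x')" "0 \<in> T (y', z', x')"
        by (cases u') (auto simp: mv_inv_def)
      then have "(y', z') = (ys, zs)"
        using T_l_zero_imp_dual_solution[of y' z' x'] dual_solutions_eq(1)[OF l]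
        by (auto simp: T_def ys_def zs_def)
      then show "ereal ?n \<le> ereal (norm (?u - u'))"
        by (simp add: u' norm_prod_def)
    qed
    \<comment> \<open>The criterion \<open>stop_B2\<close> bounds an infimum; \<open>e\<close> is the slack left for a subgradient that nearly attains it.\<close>
    have up: "?n \<le> a * (\<beta> k + e)" if e: "0 < e" "e < \<rho> - \<beta> k" for e
    proof -
      define r where "r = adjoint A (y (Suc k)) + z (Suc k) - c"
      have "set_dist 0 (subdiff (Psi h p A c \<sigma> x k) (y (Suc k), z (Suc k)))
          \<le> ereal (\<delta>' k / \<sigma> k * norm (x (Suc k) - x k))"
        using stopB2 unfolding stop_B2_def by blast
      also have "\<dots> < ereal (\<delta>' k / \<sigma> k * norm (x (Suc k) - x k) + e)" using e by simp
      finally obtain v where v: "v \<in> subdiff (Psi h p A c \<sigma> x k) (y (Suc k), z (Suc k))"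
        and vn: "norm v < \<delta>' k / \<sigma> k * norm (x (Suc k) - x k) + e"
        unfolding set_dist_def INF_less_iff by auto
      obtain v1 v2 where v12: "v = (v1, v2)" by (cases v)
      have "(v1, v2, r) \<in> T (y (Suc k), z (Suc k), x k - \<sigma> k *\<^sub>R r)"
        unfolding T_def r_def
        by (rule subgradient_shift_multiplier)
           (use v iterate_gap(3,4)[OF stop_A_gap \<epsilon>_nonneg] in \<open>auto simp: v12 Psi_def\<close>)
      then have mem: "(v1, v2, r) \<in> T ?u" unfolding r_def x_Suc[symmetric] .
      have "norm (v1, v2, r) = norm ((v1, v2, 0) + (0, 0, r))" by simp
      also have "\<dots> \<le> norm (v1, v2, 0 :: 'a) + norm (0 :: 'b, 0 :: 'a, r)" by (rule norm_triangle_ineq)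
      also have "\<dots> = norm v + norm r" by (simp add: v12 norm_prod_def)
      also have "norm r = 1 / \<sigma> k * norm (x (Suc k) - x k)"
        using \<sigma>_pos[of k] unfolding r_def residual_eq by (simp add: norm_minus_commute)
      finally have vr: "norm (v1, v2, r) < \<beta> k + e"
        using vn by (simp add: \<beta>_def add_divide_distrib algebra_simps)
      then have "(v1, v2, r) \<in> V" using \<rho>(2) e by (auto simp: subset_iff)
      with mem have mem': "(v1, v2, r) \<in> T ?u \<inter> V" by blast
      have sd: "set_dist 0 (T ?u \<inter> V) \<le> ereal (norm (v1, v2, r))"
        using INF_lower[OF mem', of "\<lambda>w. ereal (norm (0 - w))"]
        unfolding set_dist_def by (simp only: diff_0 norm_minus_cancel)
      have "ereal ?n \<le> ereal a * set_dist 0 (T ?u \<inter> V)"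
        using low reg[OF elim(1)] mem' by (blast intro: order_trans)
      also have "\<dots> \<le> ereal a * ereal (\<beta> k + e)"
        using sd vr a by (intro ereal_mult_left_mono) (auto elim: order_trans)
      finally show ?thesis by simp
    qed
    have "?n \<le> a * (\<beta> k + 0)"
    proof (rule tendsto_lowerbound)
      show "((\<lambda>e. a * (\<beta> k + e)) \<longlongrightarrow> a * (\<beta> k + 0)) (at_right 0)"
        by (intro tendsto_intros)
      show "\<forall>\<^sub>F e in at_right 0. ?n \<le> a * (\<beta> k + e)"
        by (rule eventually_mono[OF eventually_at_right_real[of 0 "\<rho> - \<beta> k"]]) (use elim up in auto)
    qed simp
    then show ?case by (simp add: \<beta>_def rate'_def ys_def zs_def mult.assoc)
  qed
qed

end

theorem theorem3:
  fixes A :: "'a::euclidean_space \<Rightarrow> 'b::euclidean_space"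
    and c :: 'a
    and p :: "'a \<Rightarrow> ereal"
    and h :: "'b \<Rightarrow> real"
    and grad_h :: "'b \<Rightarrow> 'b"
    and \<alpha>_h a_f a_l :: real
    and \<sigma> \<epsilon> \<delta> \<delta>' :: "nat \<Rightarrow> real"
    and \<sigma>_inf :: ereal
    and y :: "nat \<Rightarrow> 'b"
    and z x :: "nat \<Rightarrow> 'a"
  assumes "linear A"
    and "closed_proper_convex p"
    and "convex_on UNIV h"
    and "\<And>u. GDERIV h u :> grad_h u"
    and "\<alpha>_h > 0"
    and "(1 / \<alpha>_h)-lipschitz_on UNIV grad_h"
    and "ess_locally_strongly_convex (\<lambda>u. ereal (h u))"
    and "primal_solutions h p A c \<noteq> {}"
    and "error_bound (subdiff (primal_obj h p A c)) 0 a_f"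
    and "ssnal_sequence h p A c \<sigma> \<sigma>_inf y z x"
    and "stop_A h p A c \<sigma> y z x \<epsilon>"
    and "stop_B1 h p A c \<sigma> y z x \<delta>"
  shows "\<exists>xs \<in> primal_solutions h p A c.
           x \<longlonglongrightarrow> xs \<and>
           (\<forall>\<^sub>F k in sequentially.
              set_dist (x (Suc k)) (primal_solutions h p A c)
                \<le> ereal (rate a_f \<sigma> \<delta> k) * set_dist (x k) (primal_solutions h p A c)) \<and>
           rate a_f \<sigma> \<delta> \<longlonglongrightarrow> rate_inf a_f \<sigma>_inf \<and>
           rate_inf a_f \<sigma>_inf < 1 \<and>
           (\<exists>ys zs.
              dual_solutions h p A c = {(ys, zs)} \<and>
              ys \<in> interior (effdom (conjugate (\<lambda>u. ereal (h u)))) \<and>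
              zs \<in> effdom (conjugate p) \<and>
              (\<lambda>k. (y k, z k)) \<longlonglongrightarrow> (ys, zs) \<and>
              (metrically_subregular (T_l h p A c) (ys, zs, xs) 0 a_l \<and>
               stop_B2 h p A c \<sigma> y z x \<delta>' \<longrightarrow>
                 (\<forall>\<^sub>F k in sequentially.
                    norm ((y (Suc k), z (Suc k)) - (ys, zs))
                      \<le> rate' a_l \<sigma> \<delta>' k * norm (x (Suc k) - x k)) \<and>
                 rate' a_l \<sigma> \<delta>' \<longlonglongrightarrow> rate'_inf a_l \<sigma>_inf))"
proof -
  interpret inexact_augmented_lagrangian A c p h grad_h "1 / \<alpha>_h" \<sigma> \<epsilon> \<delta> \<sigma>_inf y z x
    by (intro inexact_augmented_lagrangian.intro smooth_composite_problem.intro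
        inexact_augmented_lagrangian_axioms.intro) (fact assms | use assms(5) in simp)+
  obtain xs where xs: "xs \<in> S" and x: "x \<longlonglongrightarrow> xs" and P: "prox_point \<longlonglongrightarrow> xs"
    using primal_convergence by blast
  have a: "a_f \<ge> 0" using assms(9) by (simp add: error_bound_def)
  have "dual_y xs \<in> interior (effdom h_conj)"
    unfolding dual_y_def by (rule interior_effdom_conjugate[OF assms(3,4,7)])
  moreover have "c - adjoint A (dual_y xs) \<in> effdom p_conj"
    using dual_solutions_eq(2)[OF xs] by (simp add: effdom_def)
  moreover have "rate' a_l \<sigma> \<delta>' \<longlonglongrightarrow> rate'_inf a_l \<sigma>_inf" if "stop_B2 h p A c \<sigma> y z x \<delta>'"
    using that by (intro rate'_limit[OF \<sigma>_pos \<sigma>_inc \<sigma>_lim]) (simp add: stop_B2_def)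
  ultimately have dual: "\<exists>ys zs. dual_solutions h p A c = {(ys, zs)} \<and> ys \<in> interior (effdom h_conj) \<and>
      zs \<in> effdom p_conj \<and> (\<lambda>k. (y k, z k)) \<longlonglongrightarrow> (ys, zs) \<and>
      (metrically_subregular (T_l h p A c) (ys, zs, xs) 0 a_l \<and> stop_B2 h p A c \<sigma> y z x \<delta>' \<longrightarrow>
        (\<forall>\<^sub>F k in sequentially. norm ((y (Suc k), z (Suc k)) - (ys, zs))
            \<le> rate' a_l \<sigma> \<delta>' k * norm (x (Suc k) - x k)) \<and>
        rate' a_l \<sigma> \<delta>' \<longlonglongrightarrow> rate'_inf a_l \<sigma>_inf)"
    using dual_solutions_eq(1)[OF xs] dual_convergence[OF x P] dual_rate[OF xs x P]
    by (intro exI[of _ "dual_y xs"] exI[of _ "c - adjoint A (dual_y xs)"]) blast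
  show ?thesis
    using primal_rate[OF x P assms(9)] rate_limit[OF \<sigma>_pos \<sigma>_inc \<sigma>_lim \<delta>_null a] dual
    by (intro bexI[OF _ xs] conjI x)
qed

end
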